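(* Let $k\geq 2$ and $n\geq 400k^{2}$ be integers, and let $G$ be a graph of order $n$. If $G$ contains no cycle of length $2k+2$ (as a subgraph), then $q(G)<q(S_{n,k}^{+})$, unless $G=S_{n,k}^{+}$ (i.e. $G$ is isomorphic to $S_{n,k}^{+}$).
   Context: All graphs are finite and simple. For a graph $G$, the signless Laplacian is $Q(G)=D(G)+A(G)$, where $D(G)$ is the diagonal matrix of vertex degrees and $A(G)$ is the adjacency matrix; $q(G)$ (the $Q$-index) denotes the largest eigenvalue of $Q(G)$. For $1\le k<n$, $S_{n,k}=K_k\vee\overline{K}_{n-k}$ is the graph obtained by joining each vertex of a complete graph of order $k$ to each vertex of an independent set of order $n-k$, and $S_{n,k}^{+}$ is the graph obtained from $S_{n,k}$ by adding one edge (necessarily between two vertices of the independent set). *)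

theory Defs
  imports
    "Graph_Theory.Graph_Theory"
    "Jordan_Normal_Form.Spectral_Radius"
begin

text \<open>
  A finite simple graph is a \<^locale>\<open>pair_graph\<close>: a finite vertex set together with a finite,
  symmetric, irreflexive set of ordered pairs, so that an edge \<open>uv\<close> is the pair of opposite
  arcs \<open>(u, v)\<close> and \<open>(v, u)\<close>, and the degree of a vertex is its out-degree.  A
  \<^const>\<open>pre_digraph.cycle\<close> may have length 2 (an edge traversed back and forth); from length 3
  on, these are exactly the rooted and oriented versions of the graph's cycles.
\<close>

text \<open>
  Rows and columns of matrices are indexed by natural numbers, so the matrices of a graph depend on
  a list \<open>vs\<close> enumerating its vertices.
\<close>

definition adjacency_matrix :: "'a pair_pre_digraph \<Rightarrow> 'a list \<Rightarrow> real mat" where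
  "adjacency_matrix G vs =
     mat (length vs) (length vs) (\<lambda>(i, j). if (vs ! i, vs ! j) \<in> parcs G then 1 else 0)"

definition degree_matrix :: "'a pair_pre_digraph \<Rightarrow> 'a list \<Rightarrow> real mat" where
  "degree_matrix G vs =
     mat (length vs) (length vs)
       (\<lambda>(i, j). if i = j then real (out_degree (with_proj G) (vs ! i)) else 0)"

definition signless_laplacian :: "'a pair_pre_digraph \<Rightarrow> 'a list \<Rightarrow> real mat" where
  "signless_laplacian G vs = degree_matrix G vs + adjacency_matrix G vs"

definition vertex_list :: "'a pair_pre_digraph \<Rightarrow> 'a list" where
  "vertex_list G = (SOME vs. distinct vs \<and> set vs = pverts G)"

text \<open>
  The matrix is real symmetric, so all its eigenvalues are real and the largest one is the maximum
  of the (finite) real spectrum.  For the graph without vertices the value is unspecified.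
\<close>

definition Q_index :: "'a pair_pre_digraph \<Rightarrow> real" where
  "Q_index G = Max (spectrum (signless_laplacian G (vertex_list G)))"

text \<open>\<open>K\<^sub>k \<or> (complement of K\<^sub>n\<^sub>-\<^sub>k)\<close> on \<open>{..<n}\<close>, where the vertices below \<open>k\<close> form the clique.\<close>

definition S_graph :: "nat \<Rightarrow> nat \<Rightarrow> nat pair_pre_digraph" where
  "S_graph n k =
     \<lparr> pverts = {..<n}, parcs = {(i, j). i < n \<and> j < n \<and> i \<noteq> j \<and> (i < k \<or> j < k)} \<rparr>"

text \<open>
  The added edge joins the vertices \<open>k\<close> and \<open>k + 1\<close> of the independent set (any other choice gives
  an isomorphic graph); this needs \<open>k + 2 \<le> n\<close>.
\<close>

definition S_plus_graph :: "nat \<Rightarrow> nat \<Rightarrow> nat pair_pre_digraph" where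
  "S_plus_graph n k =
     (S_graph n k)\<lparr> parcs := parcs (S_graph n k) \<union> {(k, k + 1), (k + 1, k)} \<rparr>"

lemma pair_graph_S_graph: "pair_graph (S_graph n k)"
proof -
  have "finite (parcs (S_graph n k))"
    by (rule finite_subset[of _ "{..<n} \<times> {..<n}"]) (auto simp: S_graph_def)
  then show ?thesis
    by unfold_locales (auto simp: S_graph_def symmetric_def sym_def)
qed

lemma pair_graph_S_plus_graph:
  assumes "k + 2 \<le> n"
  shows "pair_graph (S_plus_graph n k)"
proof -
  have "finite (parcs (S_plus_graph n k))"
    by (rule finite_subset[of _ "{..<n} \<times> {..<n}"])
      (use assms in \<open>auto simp: S_plus_graph_def S_graph_def\<close>)
  then show ?thesis
    using assms by unfold_locales (auto simp: S_plus_graph_def S_graph_def symmetric_def sym_def)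
qed

lemma vertex_list:
  assumes "finite (pverts G)"
  shows "distinct (vertex_list G)" "set (vertex_list G) = pverts G"
proof -
  have "\<exists>vs. distinct vs \<and> set vs = pverts G"
    using finite_distinct_list[OF assms] by blast
  from someI_ex[OF this] show "distinct (vertex_list G)" "set (vertex_list G) = pverts G"
    unfolding vertex_list_def by auto
qed

text \<open>The eigenvalues do not depend on how the vertices are enumerated:\<close>

lemma eigenvalue_signless_laplacian_iff:
  assumes vs: "distinct vs"
  shows "eigenvalue (signless_laplacian G vs) c \<longleftrightarrow>
    (\<exists>x. (\<exists>v\<in>set vs. x v \<noteq> 0) \<and>
      (\<forall>v\<in>set vs. real (out_degree (with_proj G) v) * x v +
         (\<Sum>u\<in>set vs. if (v, u) \<in> parcs G then x u else 0) = c * x v))"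
    (is "?L \<longleftrightarrow> ?R")
proof -
  let ?n = "length vs" and ?A = "signless_laplacian G vs"
  have dim: "dim_row ?A = ?n" "dim_col ?A = ?n"
    by (simp_all add: signless_laplacian_def adjacency_matrix_def)
  have bij: "bij_betw ((!) vs) {0..<?n} (set vs)"
    by (rule bij_betw_nth) (use vs in \<open>auto simp: atLeast0LessThan\<close>)
  have entry: "(?A *\<^sub>v vec ?n (\<lambda>i. x (vs ! i))) $ i =
      real (out_degree (with_proj G) (vs ! i)) * x (vs ! i) +
      (\<Sum>u\<in>set vs. if (vs ! i, u) \<in> parcs G then x u else 0)"
    if i: "i < ?n" for x i
  proof -
    have "(?A *\<^sub>v vec ?n (\<lambda>i. x (vs ! i))) $ i =
      (\<Sum>j = 0..<?n. ((if i = j then real (out_degree (with_proj G) (vs ! i)) else 0) +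
         (if (vs ! i, vs ! j) \<in> parcs G then 1 else 0)) * x (vs ! j))"
      using i by (auto simp: scalar_prod_def signless_laplacian_def adjacency_matrix_def
          degree_matrix_def intro!: sum.cong)
    also have "\<dots> = (\<Sum>j = 0..<?n. if i = j then real (out_degree (with_proj G) (vs ! i)) * x (vs ! i) else 0)
         + (\<Sum>j = 0..<?n. if (vs ! i, vs ! j) \<in> parcs G then x (vs ! j) else 0)"
      by (subst sum.distrib[symmetric], rule sum.cong) (auto simp: distrib_right)
    also have "(\<Sum>j = 0..<?n. if (vs ! i, vs ! j) \<in> parcs G then x (vs ! j) else 0) =
        (\<Sum>u\<in>set vs. if (vs ! i, u) \<in> parcs G then x u else 0)"
      by (rule sum.reindex_bij_betw[OF bij])
    finally show ?thesis using i by simp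
  qed
  have ev: "eigenvector ?A (vec ?n (\<lambda>i. x (vs ! i))) c \<longleftrightarrow>
     (\<exists>v\<in>set vs. x v \<noteq> 0) \<and>
      (\<forall>v\<in>set vs. real (out_degree (with_proj G) v) * x v +
         (\<Sum>u\<in>set vs. if (v, u) \<in> parcs G then x u else 0) = c * x v)" for x
  proof -
    have nz: "vec ?n (\<lambda>i. x (vs ! i)) \<noteq> 0\<^sub>v ?n \<longleftrightarrow> (\<exists>v\<in>set vs. x v \<noteq> 0)"
    proof -
      have "(\<exists>v\<in>set vs. x v \<noteq> 0) \<longleftrightarrow> (\<exists>i<?n. x (vs ! i) \<noteq> 0)"
        unfolding set_conv_nth by auto
      then show ?thesis by (auto simp: vec_eq_iff)
    qed
    have eq: "?A *\<^sub>v vec ?n (\<lambda>i. x (vs ! i)) = c \<cdot>\<^sub>v vec ?n (\<lambda>i. x (vs ! i)) \<longleftrightarrow>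
      (\<forall>i<?n. (?A *\<^sub>v vec ?n (\<lambda>i. x (vs ! i))) $ i = c * x (vs ! i))"
      by (auto simp: vec_eq_iff dim simp del: index_mult_mat_vec)
    show ?thesis
      unfolding eigenvector_def dim nz eq
      by (simp add: entry all_set_conv_all_nth del: index_mult_mat_vec)
  qed
  show ?thesis
  proof
    assume ?L
    then obtain w where w: "eigenvector ?A w c" unfolding eigenvalue_def by (rule exE)
    have "w \<in> carrier_vec ?n"
      using w unfolding eigenvector_def dim by (rule conjunct1)
    then have dw: "dim_vec w = ?n" by (rule carrier_vecD)
    define x where "x v = w $ (the_inv_into {0..<?n} ((!) vs) v)" for v
    have "the_inv_into {0..<?n} ((!) vs) (vs ! i) = i" if "i < ?n" for i
      using bij that by (intro the_inv_into_f_f) (auto simp: bij_betw_def)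
    then have wx: "w = vec ?n (\<lambda>i. x (vs ! i))"
      by (intro eq_vecI) (simp_all add: dw x_def)
    have "eigenvector ?A (vec ?n (\<lambda>i. x (vs ! i))) c"
      by (fold wx) (rule w)
    then show ?R by (intro exI[of _ x] iffD1[OF ev])
  next
    assume ?R
    then obtain x where "eigenvector ?A (vec ?n (\<lambda>i. x (vs ! i))) c"
      unfolding ev[symmetric] by (rule exE)
    then show ?L unfolding eigenvalue_def by (rule exI)
  qed
qed

lemma Q_index_eq:
  assumes "distinct vs" "set vs = pverts G"
  shows "Q_index G = Max (spectrum (signless_laplacian G vs))"
proof -
  have "finite (pverts G)" using assms(2) by (metis List.finite_set)
  note vl = vertex_list[OF this]
  have "eigenvalue (signless_laplacian G (vertex_list G)) = eigenvalue (signless_laplacian G vs)"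
    by (rule ext) (simp add: eigenvalue_signless_laplacian_iff vl assms)
  then show ?thesis
    unfolding Q_index_def spectrum_def by simp
qed

end

theory Submission
  imports Defs "HOL-Analysis.Function_Topology"
begin

text \<open>
  Suppose \<open>q = q(G) \<ge> q(S\<^sub>n\<^sub>,\<^sub>k\<^sup>+) \<ge> n + 2k - 2 - 1/200\<close>, and let \<open>x \<ge> 0\<close> be a \<open>q\<close>-eigenvector whose
  maximum is \<open>x w = 1\<close>.  Let \<open>L\<close> be the set of vertices of degree at least \<open>n/2 + 4k\<close>.  Any two of them
  have many common neighbours, so \<open>k + 1\<close> of them would lie on a cycle of length \<open>2k + 2\<close>; hence
  \<open>|L| \<le> k\<close>.  Since \<open>G\<close> has no path of \<open>2k + 1\<close> vertices with both ends in \<open>N(w)\<close> that avoids \<open>w\<close>, there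
  are \<open>O(kn)\<close> edges at \<open>N(w)\<close>; the eigenvalue equations then yield \<open>deg w \<ge> n - O(k)\<close>, so \<open>G\<close> has \<open>O(kn)\<close>
  edges in total.  Summing the eigenvalue equations gives \<open>q \<cdot> \<Sum>x = 2 \<Sum>deg v \<cdot> x v\<close>, from which the
  entries outside \<open>L\<close> are \<open>O(k/n)\<close> and \<open>\<Sum>x \<le> 2 \<Sum>\<^sub>L x + 0.22\<close>.  As \<open>\<Sum>x \<ge> 1 + q - deg w \<ge> 2k - 1/200\<close>, it
  follows that \<open>|L| = k\<close> and that all entries on \<open>L\<close> are close to 1.  Finally, the vertices adjacent to all
  of \<open>L\<close> span at most one edge, and turning \<open>G\<close> into \<open>S\<^sub>n\<^sub>,\<^sub>k\<^sup>+\<close> with clique \<open>L\<close> strictly increases the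
  quadratic form at \<open>x\<close> unless the two graphs coincide, which contradicts the Rayleigh bound for
  \<open>S\<^sub>n\<^sub>,\<^sub>k\<^sup>+\<close>.
\<close>

subsection \<open>The quadratic form of the signless Laplacian\<close>

text \<open>The spectral and combinatorial arguments need only the bare vertex and arc sets. An edge
  is a pair of opposite arcs, whence the factors 2 in sums over \<open>E\<close>.\<close>

locale sgraph =
  fixes V :: "'a set" and E :: "('a \<times> 'a) set"
  assumes finV: "finite V" and EV: "E \<subseteq> V \<times> V" and symE: "sym E" and irreflE: "irrefl E"
begin

definition nb :: "'a \<Rightarrow> 'a set" where "nb v = E `` {v}"

lemma finE: "finite E"
  using EV finV by (meson finite_SigmaI finite_subset)

lemma in_nb [simp]: "u \<in> nb v \<longleftrightarrow> (v, u) \<in> E"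
  by (simp add: nb_def)

lemma nb_sub: "nb v \<subseteq> V"
  using EV by (auto simp: nb_def)

lemma fin_nb [simp]: "finite (nb v)"
  using nb_sub finV by (rule finite_subset)

lemma E_commute: "(u, v) \<in> E \<longleftrightarrow> (v, u) \<in> E"
  using symE by (meson symD)

lemma E_irrefl [simp]: "(u, u) \<notin> E"
  using irreflE by (simp add: irrefl_def)

lemma E_Sigma: "E = Sigma V nb"
  using EV by (auto simp: nb_def)

lemma sum_arcs: "(\<Sum>(u, v)\<in>E. f u v) = (\<Sum>u\<in>V. \<Sum>v\<in>nb u. f u v)"
  by (subst E_Sigma) (simp add: sum.Sigma finV)

lemma sum_arcs_swap: "(\<Sum>(u, v)\<in>E. f u v) = (\<Sum>(u, v)\<in>E. f v u)"
  by (rule sum.reindex_bij_witness[of _ prod.swap prod.swap]) (auto intro: symD[OF symE])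

lemma sum_nb: "(\<Sum>u\<in>V. \<Sum>v\<in>nb u. f v) = (\<Sum>u\<in>V. real (card (nb u)) * f u)"
  using sum_arcs_swap[of "\<lambda>u v. f v"] unfolding sum_arcs by simp

text \<open>Twice the quadratic form of the signless Laplacian, since each edge is summed in both
  directions.\<close>

definition form :: "('a \<Rightarrow> real) \<Rightarrow> real" where
  "form x = (\<Sum>(u, v)\<in>E. (x u + x v)\<^sup>2)"

definition nsq :: "('a \<Rightarrow> real) \<Rightarrow> real" where
  "nsq x = (\<Sum>v\<in>V. (x v)\<^sup>2)"

definition Qop :: "('a \<Rightarrow> real) \<Rightarrow> 'a \<Rightarrow> real" where
  "Qop x v = real (card (nb v)) * x v + (\<Sum>u\<in>nb v. x u)"

text \<open>Reversing all arcs shows that both endpoints contribute equally. The polarised form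
  yields \<open>form_Qop\<close> as well as the first-order term in \<open>form_add\<close>.\<close>

lemma bilinear_form:
  "(\<Sum>(u, v)\<in>E. (x u + x v) * (y u + y v)) = 2 * (\<Sum>v\<in>V. y v * Qop x v)"
proof -
  have "(\<Sum>(u, v)\<in>E. (x u + x v) * (y u + y v)) =
      (\<Sum>(u, v)\<in>E. y u * (x u + x v)) + (\<Sum>(u, v)\<in>E. y v * (x v + x u))"
    by (subst sum.distrib[symmetric], rule sum.cong) (auto simp: algebra_simps)
  also have "(\<Sum>(u, v)\<in>E. y v * (x v + x u)) = (\<Sum>(u, v)\<in>E. y u * (x u + x v))"
    by (rule sum_arcs_swap)
  also have "(\<Sum>(u, v)\<in>E. y u * (x u + x v)) = (\<Sum>v\<in>V. y v * Qop x v)"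
    unfolding sum_arcs Qop_def
    by (rule sum.cong) (auto simp: sum.distrib sum_distrib_left[symmetric])
  finally show ?thesis by simp
qed

lemma form_Qop: "form x = 2 * (\<Sum>v\<in>V. x v * Qop x v)"
  unfolding form_def bilinear_form[symmetric] by (simp add: power2_eq_square)

lemma form_add:
  "form (\<lambda>v. x v + t * y v) = form x + 2 * t * (2 * (\<Sum>v\<in>V. y v * Qop x v)) + t\<^sup>2 * form y"
proof -
  have "form (\<lambda>v. x v + t * y v) =
      (\<Sum>(u, v)\<in>E. (x u + x v)\<^sup>2 + 2 * t * ((x u + x v) * (y u + y v)) + t\<^sup>2 * (y u + y v)\<^sup>2)"
    unfolding form_def by (rule sum.cong) (auto simp: power2_eq_square algebra_simps)
  then show ?thesis
    unfolding form_def bilinear_form[symmetric] by (simp add: case_prod_beta sum.distrib sum_distrib_left)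
qed

lemma nsq_add: "nsq (\<lambda>v. x v + t * y v) = nsq x + 2 * t * (\<Sum>v\<in>V. y v * x v) + t\<^sup>2 * nsq y"
  unfolding nsq_def sum_distrib_left sum.distrib[symmetric]
  by (rule sum.cong) (auto simp: power2_eq_square algebra_simps)

lemma form_scale: "form (\<lambda>v. c * x v) = c\<^sup>2 * form x"
  unfolding form_def sum_distrib_left
  by (rule sum.cong) (auto simp: power_mult_distrib distrib_left[symmetric])

lemma nsq_scale: "nsq (\<lambda>v. c * x v) = c\<^sup>2 * nsq x"
  unfolding nsq_def sum_distrib_left by (rule sum.cong) (auto simp: power_mult_distrib)

lemma nsq_nonneg: "0 \<le> nsq x"
  unfolding nsq_def by (simp add: sum_nonneg)

lemma nsq_eq_0_iff: "nsq x = 0 \<longleftrightarrow> (\<forall>v\<in>V. x v = 0)"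
  unfolding nsq_def by (subst sum_nonneg_eq_0_iff) (auto simp: finV)

lemma form_cong: "(\<And>v. v \<in> V \<Longrightarrow> x v = y v) \<Longrightarrow> form x = form y"
  unfolding form_def using EV by (intro sum.cong) auto

lemma nsq_cong: "(\<And>v. v \<in> V \<Longrightarrow> x v = y v) \<Longrightarrow> nsq x = nsq y"
  unfolding nsq_def by (intro sum.cong) auto

text \<open>Coordinates outside \<open>V\<close> are frozen at 0 and the others lie in [-1, 1], so
  the sphere is a closed subset of a product of compact intervals, to which Tychonoff's theorem
  applies.\<close>

lemma compact_sphere: "compact {x. (\<forall>v. v \<notin> V \<longrightarrow> x v = 0) \<and> nsq x = 1}" (is "compact ?K")
proof -
  define B :: "('a \<Rightarrow> real) set" where "B = (\<Pi>\<^sub>E v\<in>UNIV. {-1..1})"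
  have "compactin (product_topology (\<lambda>v. euclidean) UNIV) B"
    unfolding B_def by (subst compactin_PiE) simp
  then have B: "compact B"
    by (simp add: euclidean_product_topology)
  have "?K = B \<inter> ((\<Inter>v\<in>-V. {x. x v = 0}) \<inter> {x. nsq x = 1})"
  proof -
    have "x \<in> B" if "\<forall>v. v \<notin> V \<longrightarrow> x v = 0" "nsq x = 1" for x
    proof -
      have "\<bar>x v\<bar> \<le> 1" for v
      proof (cases "v \<in> V")
        case True
        then have "(x v)\<^sup>2 \<le> nsq x"
          unfolding nsq_def by (intro member_le_sum) (auto simp: finV)
        then show ?thesis using that by (simp add: abs_square_le_1)
      qed (use that in simp)
      then show ?thesis by (auto simp: B_def abs_le_iff minus_le_iff)
    qed
    then show ?thesis by auto
  qed
  moreover have "closed ((\<Inter>v\<in>-V. {x::'a \<Rightarrow> real. x v = 0}) \<inter> {x. nsq x = 1})"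
    unfolding nsq_def
    by (intro closed_Int closed_INT ballI closed_Collect_eq continuous_intros
        continuous_on_product_coordinates)
  ultimately show ?thesis using B by (simp add: compact_Int_closed)
qed

text \<open>A maximiser of \<open>form\<close> on the unit sphere stays one after taking absolute
  values, because no term (x u + x v)^2 decreases. Vanishing of the first variation is the
  eigenvalue equation.\<close>

lemma Rayleigh_max:
  assumes "V \<noteq> {}"
  obtains q x where "\<And>v. x v \<ge> 0" "\<exists>v\<in>V. x v \<noteq> 0" "\<And>v. v \<in> V \<Longrightarrow> Qop x v = q * x v"
    "\<And>y. form y \<le> 2 * q * nsq y"
proof -
  define K where "K = {x. (\<forall>v. v \<notin> V \<longrightarrow> x v = 0) \<and> nsq x = 1}"
  obtain v0 where v0: "v0 \<in> V" using assms by blast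
  have "(\<lambda>v. of_bool (v = v0)) \<in> K"
    using v0 finV by (auto simp: K_def nsq_def of_bool_def if_distrib[of "\<lambda>x. x\<^sup>2"] cong: if_cong)
  moreover have "continuous_on K form"
    unfolding form_def case_prod_beta
    by (intro continuous_intros continuous_on_product_then_coordinatewise)
  moreover have "compact K" unfolding K_def by (rule compact_sphere)
  ultimately obtain x0 where x0: "x0 \<in> K" "\<And>y. y \<in> K \<Longrightarrow> form y \<le> form x0"
    using continuous_attains_sup[of K form] by blast
  define x where "x v = \<bar>x0 v\<bar>" for v
  define M where "M = form x0"
  have xK: "nsq x = 1" using x0(1) by (simp add: K_def x_def nsq_def)
  have bound: "form y \<le> M * nsq y" for y
  proof (cases "nsq y = 0")
    case True
    then have "form y = form (\<lambda>_. 0)" by (intro form_cong) (simp add: nsq_eq_0_iff)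
    then show ?thesis using True by (simp add: form_def)
  next
    case False
    define s where "s = sqrt (nsq y)"
    have s: "s\<^sup>2 = nsq y" "s \<noteq> 0" using False nsq_nonneg[of y] by (auto simp: s_def)
    define z where "z v = (if v \<in> V then (1 / s) * y v else 0)" for v
    have "nsq z = nsq (\<lambda>v. (1 / s) * y v)" by (rule nsq_cong) (simp add: z_def)
    also have "\<dots> = 1" unfolding nsq_scale using s False by (simp add: power_divide)
    finally have "z \<in> K" by (simp add: K_def z_def)
    then have "form z \<le> M" unfolding M_def by (rule x0(2))
    moreover have "form z = form (\<lambda>v. (1 / s) * y v)" by (rule form_cong) (simp add: z_def)
    ultimately have "form y / s\<^sup>2 \<le> M" unfolding form_scale by (simp add: power_divide)
    then show ?thesis unfolding s(1)[symmetric] using s(2) by (simp add: divide_simps)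
  qed
  have "M \<le> form x"
    unfolding M_def form_def
  proof (rule sum_mono, clarify)
    fix u v
    have "\<bar>x0 u + x0 v\<bar> \<le> \<bar>x u + x v\<bar>" by (simp add: x_def abs_triangle_ineq)
    then show "(x0 u + x0 v)\<^sup>2 \<le> (x u + x v)\<^sup>2" by (rule abs_le_square_iff[THEN iffD1])
  qed
  then have fx: "form x = M" using bound[of x] xK by simp
  have eig: "Qop x v = M / 2 * x v" if v: "v \<in> V" for v
  proof -
    define y where "y u = (of_bool (u = v) :: real)" for u
    have pick: "(\<Sum>u\<in>V. y u * f u) = f v" for f
      using v finV by (simp add: y_def of_bool_def if_distrib[of "\<lambda>z. z * _"] cong: if_cong)
    define b where "b = 2 * (M * x v - 2 * Qop x v)"
    define c where "c = M * nsq y - form y"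
    have pos: "0 \<le> t * b + t\<^sup>2 * c" for t
      using bound[of "\<lambda>v. x v + t * y v"] unfolding form_add nsq_add fx xK pick
      by (simp add: b_def c_def algebra_simps)
    have c0: "c \<ge> 0" using bound[of y] by (simp add: c_def)
    have "b = 0"
    proof (rule ccontr)
      assume b: "b \<noteq> 0"
      \<comment> \<open>The choice t = -b/(c + 1) makes the linear term dominate; dividing by c + 1
        also covers c = 0.\<close>
      have "0 \<le> - (b / (c + 1)) * b + (- (b / (c + 1)))\<^sup>2 * c" by (rule pos)
      also have "\<dots> = - (b\<^sup>2 / (c + 1)) + (b\<^sup>2 / (c + 1)) * (c / (c + 1))"
        by (simp add: power2_eq_square)
      also have "\<dots> = (b\<^sup>2 / (c + 1)) * (c / (c + 1) - 1)" by (simp only: right_diff_distrib mult_1_right)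
      also have "\<dots> < 0" using b c0 by (intro mult_pos_neg) (auto simp: divide_simps)
      finally show False by simp
    qed
    then show ?thesis by (simp add: b_def)
  qed
  show ?thesis
  proof (rule that[of x "M / 2"])
    show "\<exists>v\<in>V. x v \<noteq> 0" using xK nsq_eq_0_iff[of x] by force
    show "form y \<le> 2 * (M / 2) * nsq y" for y using bound[of y] by simp
  qed (use eig in \<open>auto simp: x_def\<close>)
qed

end

section \<open>The \<open>Q_index\<close> as the maximum of the Rayleigh quotient\<close>

lemma sgraph_pair_graph:
  assumes "pair_graph G"
  shows "sgraph (pverts G) (parcs G)"
proof -
  interpret pair_graph G by fact
  show ?thesis
    using pair_sym_arcs pair_finite_verts
    by unfold_locales
      (auto simp: symmetric_def irrefl_def dest: arc_fst_in_verts arc_snd_in_verts no_loops)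
qed

lemma out_degree_with_proj: "out_degree (with_proj G) v = card (parcs G `` {v})"
proof -
  have "out_arcs (with_proj G) v = Pair v ` (parcs G `` {v})"
    by (auto simp: out_arcs_def)
  then show ?thesis
    by (simp add: out_degree_def card_image inj_on_def)
qed

text \<open>The value from \<open>Rayleigh_max\<close> is an eigenvalue of the matrix, and an
  eigenvector \<open>y\<close> for any eigenvalue \<open>c\<close> satisfies form y = 2 c nsq y, so
  \<open>c\<close> cannot exceed it.\<close>

lemma Q_index_spectral:
  assumes "pair_graph G" "pverts G \<noteq> {}"
  obtains x where "\<And>v. x v \<ge> 0" "\<exists>v\<in>pverts G. x v \<noteq> 0"
    "\<And>v. v \<in> pverts G \<Longrightarrow> sgraph.Qop (parcs G) x v = Q_index G * x v"
    "\<And>y. sgraph.form (parcs G) y \<le> 2 * Q_index G * sgraph.nsq (pverts G) y"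
proof -
  interpret sgraph "pverts G" "parcs G" by (rule sgraph_pair_graph) fact
  define vs where "vs = vertex_list G"
  note vs = vertex_list[OF finV, folded vs_def]
  obtain q x where qx: "\<And>v. x v \<ge> 0" "\<exists>v\<in>pverts G. x v \<noteq> 0"
    "\<And>v. v \<in> pverts G \<Longrightarrow> Qop x v = q * x v" "\<And>y. form y \<le> 2 * q * nsq y"
    using Rayleigh_max[OF assms(2)] by metis
  let ?M = "signless_laplacian G vs"
  have "real (out_degree (with_proj G) v) * y v + (\<Sum>u\<in>set vs. if (v, u) \<in> parcs G then y u else 0)
      = Qop y v" for v y
  proof -
    have "(\<Sum>u\<in>set vs. if (v, u) \<in> parcs G then y u else 0) = (\<Sum>u\<in>nb v. y u)"
      using nb_sub[of v] by (subst sum.inter_filter[symmetric]) (auto simp: vs finV intro!: sum.cong)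
    then show ?thesis by (simp add: Qop_def out_degree_with_proj nb_def)
  qed
  then have ev: "eigenvalue ?M c \<longleftrightarrow>
      (\<exists>y. (\<exists>v\<in>pverts G. y v \<noteq> 0) \<and> (\<forall>v\<in>pverts G. Qop y v = c * y v))" for c
    by (simp add: eigenvalue_signless_laplacian_iff vs)
  have "?M \<in> carrier_mat (length vs) (length vs)"
    by (simp add: signless_laplacian_def degree_matrix_def adjacency_matrix_def)
  then have "finite (spectrum ?M)" by (rule card_finite_spectrum)
  moreover have "c \<le> q" if c: "c \<in> spectrum ?M" for c
  proof -
    obtain y where y: "\<exists>v\<in>pverts G. y v \<noteq> 0" "\<And>v. v \<in> pverts G \<Longrightarrow> Qop y v = c * y v"
      using c unfolding spectrum_def mem_Collect_eq ev by auto
    have "form y = 2 * c * nsq y"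
      unfolding form_Qop nsq_def sum_distrib_left
      by (rule sum.cong) (auto simp: y(2) power2_eq_square)
    then have "c * nsq y \<le> q * nsq y" using qx(4)[of y] by simp
    moreover have "nsq y > 0" using y(1) nsq_nonneg[of y] nsq_eq_0_iff[of y] by force
    ultimately show ?thesis by simp
  qed
  moreover have "q \<in> spectrum ?M"
    using qx(2,3) unfolding spectrum_def mem_Collect_eq ev by auto
  ultimately have "Q_index G = q"
    unfolding Q_index_def vs_def[symmetric] by (rule Max_eqI)
  then show ?thesis using that qx by blast
qed

subsection \<open>Paths and cycles\<close>

text \<open>The path grows greedily at its head while its last vertex stays \<open>v\<close>:
  besides the head it has at most \<open>m\<close> vertices, fewer than the neighbours of the head
  in \<open>Y\<close>.\<close>

lemma path_of_min_degree:
  assumes "sym F" "irrefl F" "finite Y" "v \<in> Y"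
    and deg: "\<And>u. u \<in> Y \<Longrightarrow> m < card (F `` {u} \<inter> Y)"
  shows "l \<le> Suc m \<Longrightarrow> \<exists>vs. distinct vs \<and> length vs = Suc l \<and> set vs \<subseteq> Y \<and>
    successively (\<lambda>a b. (a, b) \<in> F) vs \<and> last vs = v"
proof (induction l)
  case 0
  show ?case using assms by (intro exI[of _ "[v]"]) auto
next
  case (Suc l)
  then obtain vs where vs: "distinct vs" "length vs = Suc l" "set vs \<subseteq> Y"
    "successively (\<lambda>a b. (a, b) \<in> F) vs" "last vs = v" by auto
  then obtain a as where a: "vs = a # as" by (cases vs) auto
  let ?S = "F `` {a} \<inter> Y"
  have "m < card ?S" using deg[of a] vs a by auto
  moreover have "card (set as) \<le> m" using Suc.prems vs a card_length[of as] by auto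
  ultimately have "\<not> ?S \<subseteq> set as"
    using card_mono[of "set as" ?S] by auto
  then obtain b where b: "(a, b) \<in> F" "b \<in> Y" "b \<notin> set as" by auto
  then have "b \<noteq> a" using \<open>irrefl F\<close> by (auto simp: irrefl_def)
  moreover have "(b, a) \<in> F" using b(1) \<open>sym F\<close> by (meson symD)
  ultimately show ?case
    using vs a b by (intro exI[of _ "b # vs"]) (auto simp: successively_Cons)
qed

text \<open>Deleting a vertex with at most \<open>m\<close> neighbours costs at most 2 m arcs, so
  the hypothesis survives; the process must stop at a nonempty set because the arc count stays
  positive.\<close>

lemma min_degree_of_many_arcs:
  assumes F: "sym F" and X: "finite X"
  shows "2 * m * card X < card (F \<inter> X \<times> X) \<Longrightarrow>
    \<exists>Y\<subseteq>X. Y \<noteq> {} \<and> (\<forall>u\<in>Y. m < card (F `` {u} \<inter> Y))"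
  using X
proof (induction X rule: finite_psubset_induct)
  case (psubset X)
  show ?case
  proof (cases "\<forall>u\<in>X. m < card (F `` {u} \<inter> X)")
    case True
    moreover have "X \<noteq> {}" using psubset.prems by auto
    ultimately show ?thesis by blast
  next
    case False
    then obtain v where v: "v \<in> X" "card (F `` {v} \<inter> X) \<le> m" by auto
    let ?S = "F `` {v} \<inter> X" and ?X = "X - {v}"
    have "F \<inter> X \<times> X \<subseteq> (F \<inter> ?X \<times> ?X) \<union> Pair v ` ?S \<union> (\<lambda>u. (u, v)) ` ?S"
      using symD[OF F] by auto
    then have "card (F \<inter> X \<times> X) \<le> card ((F \<inter> ?X \<times> ?X) \<union> Pair v ` ?S \<union> (\<lambda>u. (u, v)) ` ?S)"
      using psubset.hyps by (intro card_mono) auto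
    also have "\<dots> \<le> card (F \<inter> ?X \<times> ?X) + card (Pair v ` ?S) + card ((\<lambda>u. (u, v)) ` ?S)"
      by (meson add_le_mono1 card_Un_le order_trans)
    also have "\<dots> \<le> card (F \<inter> ?X \<times> ?X) + 2 * m"
      using card_image_le[of ?S "Pair v"] card_image_le[of ?S "\<lambda>u. (u, v)"] v psubset.hyps
      by simp
    finally have "2 * m * card X < card (F \<inter> ?X \<times> ?X) + 2 * m" using psubset.prems by linarith
    moreover have "card X = Suc (card ?X)"
      using v psubset.hyps by (metis card_Suc_Diff1)
    ultimately have "2 * m * card ?X < card (F \<inter> ?X \<times> ?X)" by simp
    moreover have "?X \<subset> X" using v by auto
    ultimately show ?thesis using psubset.IH[of ?X] by (meson Diff_subset order_trans)
  qed
qed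

text \<open>Parity along a bipartite path: with an odd number of vertices, both ends lie on the same
  side.\<close>

lemma successively_alternating:
  assumes "successively (\<lambda>u v. (u \<in> N) \<noteq> (v \<in> N)) vs" "vs \<noteq> []"
  shows "(hd vs \<in> N) = ((last vs \<in> N) = odd (length vs))"
  using assms by (induction vs) (auto simp: successively_Cons)

context sgraph
begin

definition has_cycle :: "nat \<Rightarrow> bool" where
  "has_cycle m \<longleftrightarrow> (\<exists>vs. distinct vs \<and> length vs = m \<and> vs \<noteq> [] \<and>
     successively (\<lambda>u v. (u, v) \<in> E) vs \<and> (last vs, hd vs) \<in> E)"

lemma has_cycleI:
  "distinct vs \<Longrightarrow> length vs = m \<Longrightarrow> vs \<noteq> [] \<Longrightarrow> successively (\<lambda>u v. (u, v) \<in> E) vs \<Longrightarrow>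
     (last vs, hd vs) \<in> E \<Longrightarrow> has_cycle m"
  unfolding has_cycle_def by blast

text \<open>More arcs would leave a subset of \<open>nb w\<close> of minimum degree at least 2k,
  hence a path of 2k + 1 vertices inside \<open>nb w\<close>; \<open>w\<close> closes it to a cycle
  of length 2k + 2.\<close>

lemma card_arcs_nb:
  assumes "\<not> has_cycle (2 * k + 2)" "k \<ge> 1"
  shows "card (E \<inter> nb w \<times> nb w) \<le> 2 * (2 * k - 1) * card (nb w)"
proof (rule ccontr)
  assume "\<not> ?thesis"
  then obtain Y where Y: "Y \<subseteq> nb w" "Y \<noteq> {}" "\<And>u. u \<in> Y \<Longrightarrow> 2 * k - 1 < card (E `` {u} \<inter> Y)"
    using min_degree_of_many_arcs[OF symE fin_nb, of "2 * k - 1" w] by (auto simp: not_le)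
  have len: "2 * k \<le> Suc (2 * k - 1)" by simp
  obtain v where "v \<in> Y" using Y(2) by blast
  moreover have "finite Y" using Y(1) fin_nb finite_subset by blast
  ultimately obtain vs where vs: "distinct vs" "length vs = Suc (2 * k)" "set vs \<subseteq> Y"
    "successively (\<lambda>a b. (a, b) \<in> E) vs"
    using path_of_min_degree[OF symE irreflE _ _ Y(3) len, of v] by blast
  then have ne: "vs \<noteq> []" by auto
  then have "hd vs \<in> nb w" "last vs \<in> nb w"
    using vs(3) Y(1) hd_in_set last_in_set by blast+
  moreover have "w \<notin> set vs" using vs(3) Y(1) by force
  ultimately have "has_cycle (2 * k + 2)"
    using vs ne by (intro has_cycleI[of "w # vs"]) (auto simp: successively_Cons E_commute)
  with assms show False by simp
qed

text \<open>As for \<open>card_arcs_nb\<close>, but in the bipartite graph between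
  \<open>nb w\<close> and the vertices beyond it. A path of 2k + 1 vertices that ends in
  \<open>nb w\<close> also starts there, so \<open>w\<close> closes it.\<close>

lemma card_arcs_nb_rest:
  assumes "\<not> has_cycle (2 * k + 2)" "k \<ge> 1"
  shows "card (E \<inter> nb w \<times> (V - nb w - {w})) \<le> (2 * k - 1) * card V"
proof (rule ccontr)
  assume neg: "\<not> ?thesis"
  define N R where "N = nb w" and "R = V - nb w - {w}"
  define F where "F = E \<inter> (N \<times> R \<union> R \<times> N)"
  have symF: "sym F" using symE unfolding F_def sym_def by blast
  have irF: "irrefl F" using irreflE by (auto simp: F_def irrefl_def)
  \<comment> \<open>\<open>F\<close> contains both orientations of the crossing edges, which
    supplies the factor 2 in the threshold of \<open>min_degree_of_many_arcs\<close>.\<close>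
  have "card (E \<inter> R \<times> N) = card (E \<inter> N \<times> R)"
    by (rule bij_betw_same_card[of prod.swap], rule bij_betw_byWitness[where f' = prod.swap])
      (auto intro: symD[OF symE])
  moreover have "card F = card (E \<inter> N \<times> R) + card (E \<inter> R \<times> N)"
    unfolding F_def Int_Un_distrib
    by (intro card_Un_disjoint finite_Int disjI1 finE) (auto simp: N_def R_def)
  ultimately have "2 * (2 * k - 1) * card V < card F"
    using neg by (auto simp: N_def R_def not_le)
  also have "F = F \<inter> V \<times> V" using EV by (auto simp: F_def)
  finally obtain Y where Y: "Y \<subseteq> V" "Y \<noteq> {}" "\<And>u. u \<in> Y \<Longrightarrow> 2 * k - 1 < card (F `` {u} \<inter> Y)"
    using min_degree_of_many_arcs[OF symF finV, of "2 * k - 1"] by blast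
  have YV: "finite Y" using Y(1) finV finite_subset by blast
  obtain u0 where u0: "u0 \<in> Y" using Y(2) by blast
  then have "F `` {u0} \<inter> Y \<noteq> {}" using Y(3)[of u0] by (metis card.empty not_less_zero)
  then obtain v where v: "v \<in> Y" "v \<in> N" using u0 by (auto simp: F_def)
  have "2 * k \<le> Suc (2 * k - 1)" by simp
  then obtain vs where vs: "distinct vs" "length vs = Suc (2 * k)" "set vs \<subseteq> Y"
    "successively (\<lambda>a b. (a, b) \<in> F) vs" "last vs = v"
    using path_of_min_degree[OF symF irF YV v(1) Y(3)] by blast
  then have ne: "vs \<noteq> []" by auto
  have "successively (\<lambda>a b. (a \<in> N) \<noteq> (b \<in> N)) vs"
    using vs(4) by (rule successively_mono) (auto simp: F_def N_def R_def)
  then have "hd vs \<in> N" using successively_alternating[of N vs] vs v ne by auto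
  \<comment> \<open>Every vertex of \<open>Y\<close> has an \<open>F\<close>-neighbour in
    \<open>Y\<close>, whereas \<open>w\<close> lies in neither part of the bipartition.\<close>
  moreover have "w \<notin> set vs"
  proof
    assume "w \<in> set vs"
    then have "w \<in> Y" using vs(3) by blast
    then have "F `` {w} \<inter> Y \<noteq> {}" using Y(3)[of w] by (metis card.empty not_less_zero)
    then show False by (auto simp: F_def N_def R_def)
  qed
  moreover have "successively (\<lambda>a b. (a, b) \<in> E) vs"
    using vs(4) by (rule successively_mono) (auto simp: F_def)
  ultimately have "has_cycle (2 * k + 2)"
    using vs ne v by (intro has_cycleI[of "w # vs"]) (auto simp: successively_Cons E_commute N_def)
  with assms show False by simp
qed

text \<open>Consecutive members of \<open>ls\<close> are linked by fresh common neighbours.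
  \<open>F\<close> is the set that these connecting vertices must avoid; the bound on common
  neighbours leaves room beyond \<open>F\<close> and the path built so far.\<close>

lemma alternating_path:
  assumes "finite F"
  shows "ls \<noteq> [] \<Longrightarrow> distinct ls \<Longrightarrow> set ls \<subseteq> F \<Longrightarrow>
    (\<And>a b. a \<in> set ls \<Longrightarrow> b \<in> set ls \<Longrightarrow> a \<noteq> b \<Longrightarrow> card F + 2 * length ls \<le> card (nb a \<inter> nb b)) \<Longrightarrow>
    \<exists>p. distinct p \<and> p \<noteq> [] \<and> hd p = hd ls \<and> last p = last ls \<and> Suc (length p) = 2 * length ls \<and>
      successively (\<lambda>u v. (u, v) \<in> E) p \<and> set p \<inter> F \<subseteq> set ls"
proof (induction ls)
  case (Cons a ls)
  show ?case
  proof (cases "ls = []")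
    case True
    then show ?thesis by (intro exI[of _ "[a]"]) auto
  next
    case False
    have "card F + 2 * length ls \<le> card (nb c \<inter> nb d)"
      if "c \<in> set ls" "d \<in> set ls" "c \<noteq> d" for c d
      using Cons.prems(4)[of c d] that by simp
    then obtain p where p: "distinct p" "p \<noteq> []" "hd p = hd ls" "last p = last ls"
      "Suc (length p) = 2 * length ls" "successively (\<lambda>u v. (u, v) \<in> E) p" "set p \<inter> F \<subseteq> set ls"
      using Cons.IH False Cons.prems(2,3) by auto
    let ?b = "hd ls"
    have b: "?b \<in> set ls" using False by simp
    have "a \<noteq> ?b" using Cons.prems(2) b by auto
    then have "card F + 2 * Suc (length ls) \<le> card (nb a \<inter> nb ?b)"
      using Cons.prems(4)[of a ?b] b by simp
    moreover have "card (F \<union> set p) \<le> card F + length p"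
      by (meson card_Un_le card_length add_left_mono order_trans)
    ultimately have "card (F \<union> set p) < card (nb a \<inter> nb ?b)" using p(5) by simp
    then have "\<not> nb a \<inter> nb ?b \<subseteq> F \<union> set p"
      using card_mono[of "F \<union> set p" "nb a \<inter> nb ?b"] \<open>finite F\<close> by auto
    then obtain g where g: "g \<in> nb a" "g \<in> nb ?b" "g \<notin> F" "g \<notin> set p" by blast
    have "a \<in> F" using Cons.prems(3) by simp
    then have "a \<notin> set p" "a \<noteq> g" using p(7) Cons.prems(2) g by auto
    then show ?thesis
      using p g False \<open>a \<in> F\<close>
      by (intro exI[of _ "a # g # p"]) (auto simp: successively_Cons E_commute)
  qed
qed simp

lemma card_Int_nb: "card (nb a) + card (nb b) \<le> card (nb a \<inter> nb b) + card V"
proof -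
  have "card (nb a \<union> nb b) \<le> card V" using nb_sub finV by (intro card_mono) auto
  then show ?thesis using card_Un_Int[of "nb a" "nb b"] by simp
qed

text \<open>Threading k + 1 such vertices gives an alternating path of 2k + 1 vertices, and one more
  common neighbour of its ends closes a cycle of length 2k + 2.\<close>

lemma card_linked_le:
  assumes "\<not> has_cycle (2 * k + 2)" "k \<ge> 2" "finite L"
    and "\<And>a b. a \<in> L \<Longrightarrow> b \<in> L \<Longrightarrow> a \<noteq> b \<Longrightarrow> 8 * k \<le> card (nb a \<inter> nb b)"
  shows "card L \<le> k"
proof (rule ccontr)
  assume "\<not> card L \<le> k"
  then obtain T where T: "T \<subseteq> L" "card T = Suc k" "finite T"
    by (meson not_less_eq_eq obtain_subset_with_card_n assms(3) infinite_super)
  then obtain ls where ls: "set ls = T" "distinct ls" by (meson finite_distinct_list)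
  then have len: "length ls = Suc k" using T distinct_card by metis
  then have ne: "ls \<noteq> []" by auto
  have com: "8 * k \<le> card (nb a \<inter> nb b)" if "a \<in> set ls" "b \<in> set ls" "a \<noteq> b" for a b
    using assms(4) that T ls by blast
  have "card T + 2 * length ls \<le> card (nb a \<inter> nb b)" if "a \<in> set ls" "b \<in> set ls" "a \<noteq> b" for a b
    using com[OF that] T len \<open>k \<ge> 2\<close> by simp
  then obtain p where p: "distinct p" "p \<noteq> []" "hd p = hd ls" "last p = last ls"
      "Suc (length p) = 2 * length ls" "successively (\<lambda>u v. (u, v) \<in> E) p"
    using alternating_path[OF T(3) ne ls(2)] ls by auto
  have "hd ls \<noteq> last ls"
    using ls len \<open>k \<ge> 2\<close> by (cases ls) (auto dest: last_in_set)
  then have "8 * k \<le> card (nb (hd ls) \<inter> nb (last ls))" using com ne by simp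
  moreover have "card (set p) \<le> 2 * k + 1" using card_length[of p] p len by simp
  ultimately have "\<not> nb (hd ls) \<inter> nb (last ls) \<subseteq> set p"
    using card_mono[of "set p" "nb (hd ls) \<inter> nb (last ls)"] \<open>k \<ge> 2\<close> by auto
  then obtain g where g: "g \<in> nb (hd ls)" "g \<in> nb (last ls)" "g \<notin> set p" by blast
  have "has_cycle (2 * k + 2)"
    using p g len by (intro has_cycleI[of "g # p"]) (auto simp: successively_Cons E_commute)
  with assms show False by simp
qed

text \<open>A path on three vertices or two disjoint edges inside \<open>W\<close> would close up through \<open>L\<close> to a cycle of
  length \<open>2k + 2\<close>.\<close>

lemma at_most_one_edge:
  assumes cyc: "\<not> has_cycle (2 * k + 2)" and k: "k \<ge> 2" and L: "finite L" "card L = k"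
    and com: "\<And>a b. a \<in> L \<Longrightarrow> b \<in> L \<Longrightarrow> a \<noteq> b \<Longrightarrow> 8 * k \<le> card (nb a \<inter> nb b)"
    and W: "W \<inter> L = {}" "\<And>u l. u \<in> W \<Longrightarrow> l \<in> L \<Longrightarrow> (u, l) \<in> E"
    and ab: "a \<in> W" "b \<in> W" "(a, b) \<in> E" and cd: "c \<in> W" "d \<in> W" "(c, d) \<in> E"
  shows "{a, b} = {c, d}"
proof (rule ccontr)
  assume neq: "{a, b} \<noteq> {c, d}"
  obtain ls where ls: "set ls = L" "distinct ls" using L by (meson finite_distinct_list)
  have len: "length ls = k" using ls L distinct_card by metis
  have EL: "(u, l) \<in> E" "(l, u) \<in> E" if "u \<in> W" "l \<in> L" for u l
    using W(2) that E_commute by blast+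
  \<comment> \<open>Three vertices x, y, z followed by an alternating path through all
    \<open>k\<close> vertices of \<open>L\<close> form a cycle of length 3 + (2k - 1).\<close>
  have no_P3: False
    if "x \<in> W" "y \<in> W" "z \<in> W" "x \<noteq> z" "(x, y) \<in> E" "(y, z) \<in> E" for x y z
  proof -
    let ?F = "L \<union> {x, y, z}"
    have "card ?F \<le> k + 3"
      using card_Un_le[of L "{x, y, z}"] L card_length[of "[x, y, z]"] by simp
    then have "card ?F + 2 * length ls \<le> card (nb a \<inter> nb b)"
      if "a \<in> set ls" "b \<in> set ls" "a \<noteq> b" for a b
      using com[of a b] that ls len k by simp
    moreover have "ls \<noteq> []" using len k by auto
    ultimately obtain p where p: "distinct p" "p \<noteq> []" "hd p = hd ls" "last p = last ls"
      "Suc (length p) = 2 * length ls" "successively (\<lambda>u v. (u, v) \<in> E) p" "set p \<inter> ?F \<subseteq> set ls"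
      using alternating_path[of ?F ls] ls L by auto
    have "x \<notin> set p" "y \<notin> set p" "z \<notin> set p" using p(7) W(1) that ls by blast+
    moreover have "hd ls \<in> L" "last ls \<in> L" using ls \<open>ls \<noteq> []\<close> by auto
    moreover have "x \<noteq> y" "y \<noteq> z" using that by auto
    ultimately have "has_cycle (2 * k + 2)"
      using p that EL len
      by (intro has_cycleI[of "x # y # z # p"]) (auto simp: successively_Cons)
    with cyc show False by simp
  qed
  have ne: "a \<noteq> b" "c \<noteq> d" using ab cd by auto
  have rev: "(b, a) \<in> E" "(d, c) \<in> E" using ab cd E_commute by blast+
  have dist: "a \<noteq> c" "a \<noteq> d" "b \<noteq> c" "b \<noteq> d"
    using no_P3[of b a d] no_P3[of b a c] no_P3[of a b d] no_P3[of a b c] neq ab cd rev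
    by blast+
  \<comment> \<open>For disjoint edges one vertex \<open>l\<close> of \<open>L\<close> joins them as
    a, b, l, c, d, and an alternating path through the other k - 1 closes the cycle: 5 + (2k - 3)
    vertices.\<close>
  obtain l ms where l: "ls = l # ms" using len k by (cases ls) auto
  let ?F = "L \<union> {a, b, c, d}"
  have "card ?F \<le> k + 4"
    using card_Un_le[of L "{a, b, c, d}"] L card_length[of "[a, b, c, d]"] by simp
  then have "card ?F + 2 * length ms \<le> card (nb x \<inter> nb y)"
    if "x \<in> set ms" "y \<in> set ms" "x \<noteq> y" for x y
  proof -
    have "x \<in> L" "y \<in> L" using that ls l by auto
    then show ?thesis using com[of x y] \<open>x \<noteq> y\<close> \<open>card ?F \<le> k + 4\<close> len k l by simp
  qed
  moreover have "ms \<noteq> []" using len k l by auto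
  ultimately obtain p where p: "distinct p" "p \<noteq> []" "hd p = hd ms" "last p = last ms"
    "Suc (length p) = 2 * length ms" "successively (\<lambda>u v. (u, v) \<in> E) p" "set p \<inter> ?F \<subseteq> set ms"
    using alternating_path[of ?F ms] ls L l by auto
  have "l \<in> L" "l \<notin> set ms" "set ms \<subseteq> L" using l ls by auto
  then have "a \<notin> set p" "b \<notin> set p" "c \<notin> set p" "d \<notin> set p" "l \<notin> set p"
    using p(7) W(1) ab cd by blast+
  moreover have "hd ms \<in> L" "last ms \<in> L" using \<open>set ms \<subseteq> L\<close> \<open>ms \<noteq> []\<close> by auto
  moreover have "l \<notin> {a, b, c, d}" using \<open>l \<in> L\<close> W(1) ab cd by auto
  ultimately have "has_cycle (2 * k + 2)"
    using p ab cd EL len l dist ne \<open>l \<in> L\<close>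
    by (intro has_cycleI[of "a # b # l # c # d # p"]) (auto simp: successively_Cons)
  with cyc show False by simp
qed

end

section \<open>From closed vertex lists to arc lists of the graph library\<close>

lemma pcas_zip:
  assumes "vs \<noteq> []" "successively (\<lambda>u v. (u, v) \<in> F) vs" "(last vs, z) \<in> F"
  shows "pcas (hd vs) (zip vs (tl vs @ [z])) z \<and> pawalk_verts (hd vs) (zip vs (tl vs @ [z])) = vs @ [z] \<and>
    set (zip vs (tl vs @ [z])) \<subseteq> F"
  using assms
proof (induction vs)
  case (Cons v vs)
  then show ?case by (cases vs) auto
qed simp

text \<open>Pairing each vertex with its successor in the rotated list gives the arc list of a
  closed walk from \<open>hd vs\<close>, whose vertices after the first are distinct.\<close>

lemma cycle_of_has_cycle:
  assumes "pair_graph G" "sgraph.has_cycle (parcs G) m"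
  shows "\<exists>p. pre_digraph.cycle (with_proj G) p \<and> length p = m"
proof -
  interpret sgraph "pverts G" "parcs G" by (rule sgraph_pair_graph) fact
  obtain vs where vs: "distinct vs" "length vs = m" "vs \<noteq> []"
    "successively (\<lambda>u v. (u, v) \<in> parcs G) vs" "(last vs, hd vs) \<in> parcs G"
    using assms(2) unfolding has_cycle_def by blast
  define p where "p = zip vs (tl vs @ [hd vs])"
  note p = pcas_zip[OF vs(3-5), folded p_def]
  have "hd vs \<in> pverts G" using EV vs(5) by auto
  then have "pre_digraph.cycle (with_proj G) p"
    unfolding pre_digraph.cycle_def pre_digraph.awalk_def
    using p vs by (intro exI[of _ "hd vs"])
      (auto simp: cas_with_proj_eq awalk_verts_with_proj_eq p_def neq_Nil_conv)
  moreover have "length p = m" using vs by (cases vs) (auto simp: p_def)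
  ultimately show ?thesis by blast
qed

subsection \<open>The dominating vertices\<close>

context sgraph
begin

lemma sum_card_nb_Int:
  assumes "X \<subseteq> V"
  shows "(\<Sum>v\<in>X. card (nb v \<inter> Y)) = card (E \<inter> X \<times> Y)"
proof -
  have "finite X" using assms finV by (rule finite_subset)
  then have "(\<Sum>v\<in>X. card (nb v \<inter> Y)) = card (Sigma X (\<lambda>v. nb v \<inter> Y))"
    by (subst card_SigmaI) auto
  also have "Sigma X (\<lambda>v. nb v \<inter> Y) = E \<inter> X \<times> Y" by auto
  finally show ?thesis .
qed

text \<open>With N = nb w and R the vertices beyond, arcs at \<open>N\<close> go to
  \<open>w\<close>, into \<open>N\<close> or into \<open>R\<close>, for a total of at most (1 + 2(2k
  - 1) + (2k - 1)) n. Inside \<open>R\<close> only the trivial bound |R|^2 is used.\<close>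

lemma degree_sums:
  assumes "\<not> has_cycle (2 * k + 2)" "k \<ge> 1" and w: "w \<in> V"
  shows "(\<Sum>v\<in>nb w. card (nb v)) + 2 * card V \<le> 6 * k * card V" (is ?A)
    and "(\<Sum>v\<in>V. card (nb v)) + 2 * card V \<le> 8 * k * card V + (card (V - nb w - {w}))\<^sup>2" (is ?B)
proof -
  define N R n where "N = nb w" and "R = V - nb w - {w}" and "n = card V"
  have NR: "N \<subseteq> V" "R \<subseteq> V" using nb_sub by (auto simp: N_def R_def)
  have fin: "finite N" "finite R" using NR finV finite_subset by blast+
  have d: "card N \<le> n" unfolding n_def using NR finV card_mono by blast
  obtain j where j: "k = Suc j" using \<open>k \<ge> 1\<close> by (cases k) auto
  have NN: "card (E \<inter> N \<times> N) \<le> 2 * (2 * k - 1) * n"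
    using card_arcs_nb[OF assms(1,2), of w] d unfolding N_def
    by (meson mult_le_mono2 order_trans)
  have NRarcs: "card (E \<inter> N \<times> R) \<le> (2 * k - 1) * n"
    using card_arcs_nb_rest[OF assms(1,2), of w] unfolding N_def R_def n_def .
  have RN: "card (E \<inter> R \<times> N) = card (E \<inter> N \<times> R)"
    by (rule bij_betw_same_card[of prod.swap], rule bij_betw_byWitness[where f' = prod.swap])
      (auto intro: symD[OF symE])
  have "(\<Sum>v\<in>N. card (nb v)) \<le> (\<Sum>v\<in>N. 1 + card (nb v \<inter> N) + card (nb v \<inter> R))"
  proof (rule sum_mono)
    fix v
    have "nb v \<subseteq> {w} \<union> (nb v \<inter> N) \<union> (nb v \<inter> R)"
      using nb_sub[of v] by (auto simp: N_def R_def)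
    then have "card (nb v) \<le> card ({w} \<union> (nb v \<inter> N) \<union> (nb v \<inter> R))"
      by (intro card_mono) auto
    also have "\<dots> \<le> card {w} + card (nb v \<inter> N) + card (nb v \<inter> R)"
      by (meson add_le_mono1 card_Un_le order_trans)
    finally show "card (nb v) \<le> 1 + card (nb v \<inter> N) + card (nb v \<inter> R)" by simp
  qed
  also have "\<dots> = card N + card (E \<inter> N \<times> N) + card (E \<inter> N \<times> R)"
    by (simp only: sum.distrib sum_card_nb_Int[OF NR(1)] sum_constant)
      simp
  finally have A: "(\<Sum>v\<in>N. card (nb v)) + 2 * n \<le> 6 * k * n"
    using d NN NRarcs by (simp add: j algebra_simps)
  then show ?A by (simp add: N_def n_def)
  have "(\<Sum>v\<in>R. card (nb v)) \<le> (\<Sum>v\<in>R. card (nb v \<inter> N) + card R)"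
  proof (rule sum_mono)
    fix v assume v: "v \<in> R"
    then have "nb v \<subseteq> (nb v \<inter> N) \<union> R"
      using nb_sub[of v] by (auto simp: N_def R_def E_commute)
    then have "card (nb v) \<le> card ((nb v \<inter> N) \<union> R)"
      using fin by (intro card_mono) auto
    also have "\<dots> \<le> card (nb v \<inter> N) + card R" by (rule card_Un_le)
    finally show "card (nb v) \<le> card (nb v \<inter> N) + card R" .
  qed
  also have "\<dots> = card (E \<inter> N \<times> R) + (card R)\<^sup>2"
    by (simp add: sum.distrib sum_card_nb_Int[OF NR(2)] RN power2_eq_square)
  finally have R: "(\<Sum>v\<in>R. card (nb v)) \<le> (2 * k - 1) * n + (card R)\<^sup>2"
    using NRarcs by simp
  have "V = insert w (N \<union> R)" using NR w by (auto simp: N_def R_def)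
  then have "(\<Sum>v\<in>V. card (nb v)) = (\<Sum>v\<in>insert w (N \<union> R). card (nb v))" by simp
  also have "\<dots> = card (nb w) + (\<Sum>v\<in>N \<union> R. card (nb v))"
    using fin by (subst sum.insert) (auto simp: N_def R_def)
  also have "(\<Sum>v\<in>N \<union> R. card (nb v)) = (\<Sum>v\<in>N. card (nb v)) + (\<Sum>v\<in>R. card (nb v))"
    using fin by (intro sum.union_disjoint) (auto simp: N_def R_def)
  finally have "(\<Sum>v\<in>V. card (nb v)) = card N + (\<Sum>v\<in>N. card (nb v)) + (\<Sum>v\<in>R. card (nb v))"
    by (simp add: N_def)
  then show ?B
    using A R d by (simp add: j algebra_simps R_def[symmetric] n_def[symmetric])
qed

lemma dominating_set:
  fixes x :: "'a \<Rightarrow> real" and q :: real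
  defines "n \<equiv> card V"
  assumes k: "k \<ge> 2" and n: "n \<ge> 400 * k\<^sup>2" and cyc: "\<not> has_cycle (2 * k + 2)"
    and x: "\<And>v. v \<in> V \<Longrightarrow> 0 \<le> x v" "\<And>v. v \<in> V \<Longrightarrow> x v \<le> 1" and w: "w \<in> V" "x w = 1"
    and eig: "\<And>v. v \<in> V \<Longrightarrow> Qop x v = q * x v"
    and q: "q \<ge> real n + 2 * real k - 2 - 1 / 200"
  obtains L where "L \<subseteq> V" "card L = k" "\<And>l. l \<in> L \<Longrightarrow> x l \<ge> 22 / 25"
    "\<And>a b. a \<in> L \<Longrightarrow> b \<in> L \<Longrightarrow> a \<noteq> b \<Longrightarrow> 8 * k \<le> card (nb a \<inter> nb b)"
    "\<And>v. v \<in> V - L \<Longrightarrow> x v \<le> 11 / 2 * k / n"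
    "\<And>v. v \<in> V - L \<Longrightarrow> real (card (nb v)) \<le> 51 / 100 * n"
proof -
  define K N where "K = real k" and "N = real n"
  define deg where "deg v = real (card (nb v))" for v
  \<comment> \<open>The threshold is chosen so that inclusion-exclusion gives two members of
    \<open>L\<close> at least 8k common neighbours.\<close>
  define L where "L = {v \<in> V. n + 8 * k \<le> 2 * card (nb v)}"
  define S where "S = (\<Sum>v\<in>V. x v)"
  define \<beta> where "\<beta> = (\<Sum>v\<in>L. x v)"
  have K2: "K \<ge> 2" using k by (simp add: K_def)
  have NK2: "N \<ge> 400 * K\<^sup>2" using n of_nat_mono[OF n, where ?'a = real] by (simp add: N_def K_def)
  have "K\<^sup>2 \<ge> 2 * K" using K2 by (simp add: power2_eq_square)
  then have NK: "N \<ge> 800 * K" using NK2 by simp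
  have Npos: "N > 0" using NK K2 by simp
  have q': "q \<ge> N + 2 * K - 2 - 1 / 200" using q by (simp add: N_def K_def)
  have qN: "q \<ge> N" using q' K2 by simp
  have LV: "L \<subseteq> V" "finite L" using finV by (auto simp: L_def)
  have deg_le: "deg v \<le> N - 1" if "v \<in> V" for v
  proof -
    have "nb v \<subset> V" using nb_sub that by (auto simp: psubset_eq)
    then have "card (nb v) < n" unfolding n_def using finV psubset_card_mono by blast
    then show ?thesis by (simp add: deg_def N_def)
  qed
  have com: "8 * k \<le> card (nb a \<inter> nb b)" if "a \<in> L" "b \<in> L" "a \<noteq> b" for a b
    using that card_Int_nb[of a b] by (simp add: L_def n_def)
  have "card L \<le> k" by (rule card_linked_le[OF cyc k LV(2) com])
  then have Lk: "real (card L) \<le> K" by (simp add: K_def)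
  have small: "deg v \<le> 51 / 100 * N" "49 / 100 * N \<le> q - deg v" if "v \<in> V - L" for v
  proof -
    have "2 * card (nb v) \<le> n + 8 * k" using that by (auto simp: L_def)
    then have "2 * deg v \<le> N + 8 * K"
      using of_nat_mono[of "2 * card (nb v)" "n + 8 * k", where ?'a = real]
      by (simp add: deg_def N_def K_def)
    then show "deg v \<le> 51 / 100 * N" "49 / 100 * N \<le> q - deg v" using NK K2 q' by linarith+
  qed
  have eq: "(q - deg v) * x v = (\<Sum>u\<in>nb v. x u)" if "v \<in> V" for v
    using eig[OF that] by (simp add: Qop_def deg_def algebra_simps)
  have nb_le: "(\<Sum>u\<in>nb v. x u) \<le> deg v" for v
  proof -
    have "(\<Sum>u\<in>nb v. x u) \<le> (\<Sum>u\<in>nb v. 1)" using x(2) nb_sub by (intro sum_mono) blast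
    then show ?thesis by (simp add: deg_def)
  qed
  have x_small: "x v \<le> c / (49 / 100 * N)" if v: "v \<in> V - L" and c: "(\<Sum>u\<in>nb v. x u) \<le> c" for v c
  proof -
    have "49 / 100 * N * x v \<le> (q - deg v) * x v"
      using small(2)[OF v] x(1) v by (intro mult_right_mono) auto
    also have "\<dots> \<le> c" using eq v c by simp
    finally show ?thesis using Npos by (simp add: field_simps)
  qed
  have deg0: "deg v \<ge> 0" for v by (simp add: deg_def)
  note ds = degree_sums[OF cyc _ w(1), folded n_def]
  have D1: "(\<Sum>v\<in>nb w. deg v) \<le> 6 * K * N"
    using of_nat_mono[OF ds(1), where ?'a = real] k by (simp add: deg_def K_def N_def)
  have nbV: "nb w \<subseteq> V" by (rule nb_sub)
  have qd: "q - deg w = (\<Sum>u\<in>nb w. x u)" using eq[OF w(1)] w(2) by simp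
  \<comment> \<open>Members of \<open>L\<close> count at most 1 each; any other \<open>u\<close> has
    weight at most deg u / (0.49 N), because its neighbours have weight at most 1. The total is at
    most (1 + 6/0.49) K < 13.3 K.\<close>
  have "(\<Sum>u\<in>nb w. x u) \<le> (\<Sum>u\<in>nb w. of_bool (u \<in> L) + deg u / (49 / 100 * N))"
  proof (rule sum_mono)
    fix u assume "u \<in> nb w"
    then have u: "u \<in> V" using nbV by blast
    have "0 \<le> deg u / (49 / 100 * N)" using deg0 Npos by simp
    then show "x u \<le> of_bool (u \<in> L) + deg u / (49 / 100 * N)"
      using x(2)[OF u] x_small[OF _ nb_le, of u] u by (cases "u \<in> L") auto
  qed
  also have "\<dots> = real (card (nb w \<inter> L)) + (\<Sum>u\<in>nb w. deg u) / (49 / 100 * N)"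
    by (simp only: sum.distrib sum_divide_distrib[symmetric]) (simp add: Int_def)
  also have "\<dots> \<le> K + 6 * K * N / (49 / 100 * N)"
  proof (intro add_mono divide_right_mono D1)
    show "real (card (nb w \<inter> L)) \<le> K"
      using card_mono[of L "nb w \<inter> L"] LV(2) Lk by auto
  qed (use Npos in simp)
  also have "\<dots> \<le> 133 / 10 * K" using Npos K2 by simp
  finally have qd_le: "q - deg w \<le> 133 / 10 * K" unfolding qd .
  \<comment> \<open>\<open>r\<close> counts the non-neighbours of \<open>w\<close> other than
    \<open>w\<close>. Since r \<le> 13.3 K and N \<ge> 400 K^2, the quadratic term of
    \<open>degree_sums\<close> is absorbed by \<open>N\<close>.\<close>
  define r where "r = real (card (V - nb w - {w}))"
  have "V - nb w - {w} = V - insert w (nb w)" by auto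
  then have "card (V - nb w - {w}) = n - card (insert w (nb w))"
    unfolding n_def using w(1) nbV by (simp add: card_Diff_subset)
  moreover have "card (insert w (nb w)) = Suc (card (nb w))" by simp
  moreover have "card (insert w (nb w)) \<le> n"
    unfolding n_def using w(1) nbV finV by (intro card_mono) auto
  ultimately have r: "r = N - 1 - deg w" by (simp add: r_def N_def deg_def)
  have "r \<le> 133 / 10 * K" using qd_le qN r by simp
  moreover have "0 \<le> r" by (simp add: r_def)
  ultimately have "r\<^sup>2 \<le> (133 / 10 * K)\<^sup>2" by (rule power_mono)
  also have "\<dots> = 17689 / 100 * K\<^sup>2" by (simp add: power_mult_distrib power_divide)
  also have "\<dots> \<le> N" using NK2 zero_le_power2[of K] by linarith
  finally have r2: "r\<^sup>2 \<le> N" .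
  have D: "(\<Sum>v\<in>V. deg v) \<le> 8 * K * N"
  proof -
    have "(\<Sum>v\<in>V. deg v) + 2 * N \<le> 8 * K * N + r\<^sup>2"
      using of_nat_mono[OF ds(2), where ?'a = real] k by (simp add: deg_def K_def N_def r_def)
    then show ?thesis using r2 Npos by linarith
  qed
  have S0: "S \<ge> 0" unfolding S_def using x(1) by (rule sum_nonneg)
  have qS: "q * S = 2 * (\<Sum>v\<in>V. deg v * x v)"
  proof -
    have "q * S = (\<Sum>v\<in>V. Qop x v)" by (simp add: S_def sum_distrib_left eig)
    also have "\<dots> = 2 * (\<Sum>v\<in>V. deg v * x v)"
      by (simp add: Qop_def sum.distrib sum_nb deg_def)
    finally show ?thesis .
  qed
  have NS: "N * S \<le> q * S" using qN S0 by (rule mult_right_mono)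
  have "(\<Sum>v\<in>V. deg v * x v) \<le> (\<Sum>v\<in>V. deg v)"
    using x deg0 by (intro sum_mono) (simp add: mult_left_le)
  then have "N * S \<le> N * (16 * K)" using NS qS D by (simp add: algebra_simps)
  then have S16: "S \<le> 16 * K" using Npos by simp
  have nbS: "(\<Sum>u\<in>nb v. x u) \<le> S" for v
    unfolding S_def using nb_sub x(1) finV by (intro sum_mono2) auto
  have beta: "\<beta> \<le> real (card L)"
    unfolding \<beta>_def using sum_bounded_above[of L x 1] x(2) LV by auto
  \<comment> \<open>Any bound \<open>c\<close> on \<open>S\<close> makes the entries outside
    \<open>L\<close> at most c / (0.49 N). Feeding this into the degree-weighted sum bounds
    \<open>S\<close> by 2 \<beta> plus an error of order K c / N.\<close>
  have bootstrap: "S \<le> 2 * \<beta> + 16 * K * c / (49 / 100 * N)" if c: "S \<le> c" for c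
  proof -
    have c0: "c / (49 / 100 * N) \<ge> 0" using c S0 Npos by simp
    have "(\<Sum>v\<in>V. deg v * x v) = (\<Sum>v\<in>L. deg v * x v) + (\<Sum>v\<in>V - L. deg v * x v)"
      using LV finV by (metis add.commute sum.subset_diff)
    also have "(\<Sum>v\<in>L. deg v * x v) \<le> (\<Sum>v\<in>L. N * x v)"
    proof (rule sum_mono)
      fix v assume "v \<in> L"
      then have "v \<in> V" using LV by blast
      then show "deg v * x v \<le> N * x v"
        using deg_le[of v] x(1)[of v] by (intro mult_right_mono) auto
    qed
    also have "(\<Sum>v\<in>V - L. deg v * x v) \<le> (\<Sum>v\<in>V - L. deg v * (c / (49 / 100 * N)))"
      using x_small c nbS order_trans deg0 by (intro sum_mono mult_left_mono) blast+
    also have "\<dots> \<le> (\<Sum>v\<in>V. deg v * (c / (49 / 100 * N)))"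
      by (intro sum_mono2 mult_nonneg_nonneg finV deg0 c0) auto
    also have "\<dots> = (\<Sum>v\<in>V. deg v) * (c / (49 / 100 * N))" by (rule sum_distrib_right[symmetric])
    also have "\<dots> \<le> 8 * K * N * (c / (49 / 100 * N))" using D c0 by (rule mult_right_mono)
    finally have "N * S \<le> 2 * ((\<Sum>v\<in>L. N * x v) + 8 * K * N * (c / (49 / 100 * N)))"
      using NS qS by simp
    also have "\<dots> = N * (2 * \<beta> + 16 * K * c / (49 / 100 * N))"
      by (simp add: \<beta>_def sum_distrib_left[symmetric] algebra_simps)
    finally show ?thesis using Npos by simp
  qed
  have KN: "K * K / N \<le> 1 / 400" using NK2 Npos by (simp add: power2_eq_square field_simps)
  \<comment> \<open>Two rounds: the bound 16 K has error below 1.31, and 2 K + 1.31 \<le> 2.66 K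
    since K \<ge> 2; the bound 2.66 K then has error below 0.22.\<close>
  have "S \<le> 2 * \<beta> + 16 * K * (16 * K) / (49 / 100 * N)" by (rule bootstrap[OF S16])
  also have "16 * K * (16 * K) / (49 / 100 * N) = 25600 / 49 * (K * K / N)" by simp
  finally have "S \<le> 2 * K + 131 / 100" using KN beta Lk by simp
  then have S2: "S \<le> 266 / 100 * K" using K2 by simp
  have "S \<le> 2 * \<beta> + 16 * K * (266 / 100 * K) / (49 / 100 * N)" by (rule bootstrap[OF S2])
  also have "16 * K * (266 / 100 * K) / (49 / 100 * N) = 4256 / 49 * (K * K / N)" by simp
  finally have S3: "S \<le> 2 * \<beta> + 22 / 100" using KN by simp
  \<comment> \<open>The eigenvalue equation at \<open>w\<close> bounds \<open>S\<close> from below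
    by 1 + q - deg w. Hence \<beta> is within 0.1125 of \<open>K\<close>, which forces |L| = k and
    each entry on \<open>L\<close> to be at least 0.8875.\<close>
  have "(\<Sum>u\<in>insert w (nb w). x u) \<le> S"
    unfolding S_def using nbV w(1) x(1) finV by (intro sum_mono2) auto
  then have "1 + (q - deg w) \<le> S" using w(2) qd by simp
  then have "2 * K - 1 / 200 \<le> S" using deg_le[OF w(1)] q' by simp
  then have beta_ge: "\<beta> \<ge> K - 1125 / 10000" using S3 by simp
  then have "real k - 1 < real (card L)" using beta by (simp add: K_def)
  then have cardL: "card L = k" using \<open>card L \<le> k\<close> by linarith
  show ?thesis
  proof (rule that[OF LV(1) cardL])
    fix l assume l: "l \<in> L"
    have "\<beta> = x l + (\<Sum>v\<in>L - {l}. x v)" unfolding \<beta>_def using LV(2) l by (rule sum.remove)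
    also have "(\<Sum>v\<in>L - {l}. x v) \<le> real (card (L - {l}))"
      using sum_bounded_above[of "L - {l}" x 1] x(2) LV by auto
    also have "real (card (L - {l})) = K - 1" using l LV(2) cardL k by (simp add: K_def of_nat_diff)
    finally show "x l \<ge> 22 / 25" using beta_ge by simp
  next
    fix v assume v: "v \<in> V - L"
    have "x v \<le> 266 / 100 * K / (49 / 100 * N)" using x_small[OF v] nbS S2 order_trans by blast
    also have "\<dots> = 266 / 49 * (K / N)" by simp
    also have "\<dots> \<le> 11 / 2 * (K / N)" using K2 Npos by (intro mult_right_mono) auto
    finally show "x v \<le> 11 / 2 * k / n" by (simp add: K_def N_def)
    show "real (card (nb v)) \<le> 51 / 100 * n" using small(1)[OF v] by (simp add: deg_def N_def)
  qed (rule com)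
qed

end

subsection \<open>Comparison with the extremal graph\<close>

text \<open>The arcs of \<open>S\<^sub>n\<^sub>,\<^sub>k\<^sup>+\<close> placed on \<open>V\<close>, with clique \<open>L\<close> and additional edge \<open>ab\<close>.\<close>

definition join_plus :: "'a set \<Rightarrow> 'a set \<Rightarrow> 'a \<Rightarrow> 'a \<Rightarrow> ('a \<times> 'a) set" where
  "join_plus V L a b = {(u, v) \<in> V \<times> V. u \<noteq> v \<and> (u \<in> L \<or> v \<in> L)} \<union> {(a, b), (b, a)}"

text \<open>One test vector in the Rayleigh bound suffices. All terms of \<open>form\<close> are
  nonnegative, so it is estimated from below by the arcs inside the clique and those between the
  clique and the other vertices.\<close>

lemma Q_index_S_plus_ge:
  assumes k: "k \<ge> 2" and n: "n \<ge> 400 * k\<^sup>2"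
  shows "Q_index (S_plus_graph n k) \<ge> real n + 2 * real k - 2 - 1 / 200"
proof -
  let ?G = "S_plus_graph n k" and ?q = "Q_index (S_plus_graph n k)"
  have "k * 1 \<le> k * k" using k by (intro mult_le_mono2) simp
  then have "800 * k \<le> 400 * k\<^sup>2" using k by (simp add: power2_eq_square)
  then have nk: "800 * k \<le> n" using n by simp
  have G: "pair_graph ?G" using nk k by (intro pair_graph_S_plus_graph) simp
  have V: "pverts ?G = {..<n}" by (simp add: S_plus_graph_def S_graph_def)
  interpret sgraph "pverts ?G" "parcs ?G" by (rule sgraph_pair_graph[OF G])
  have "0 < n" using nk k by simp
  then have ne: "pverts ?G \<noteq> {}" unfolding V by blast
  have Ray: "form y \<le> 2 * ?q * nsq y" for y
    using Q_index_spectral[OF G ne] by blast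
  define t where "t = real k / real n"
  \<comment> \<open>\<open>(1, \<dots>, 1, k/n, \<dots>, k/n)\<close> approximates the principal eigenvector of \<open>S\<^sub>n\<^sub>,\<^sub>k\<close>.\<close>
  define y where "y i = (if i < k then 1 else t)" for i
  define A B where "A = {..<k} \<times> {..<k} - Id_on {..<k}" and "B = {..<k} \<times> {k..<n}"
  have t: "0 < t" "t \<le> 1 / 800" using nk k by (auto simp: t_def field_simps)
  have npos: "real n > 0" using nk k by simp
  have tk: "real k = t * real n" using npos by (simp add: t_def)
  have cA: "real (card A) = real k * real k - real k"
  proof -
    have "Id_on {..<k} = (\<lambda>i. (i, i)) ` {..<k}" by auto
    then have "card (Id_on {..<k}) = k" "finite (Id_on {..<k})"
      by (simp_all add: card_image inj_on_def)
    then have "card A = k * k - k" unfolding A_def by (subst card_Diff_subset) auto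
    then show ?thesis using \<open>k * 1 \<le> k * k\<close> by (simp add: of_nat_diff)
  qed
  have cB: "real (card B) = real k * (real n - real k)"
    using nk by (simp add: B_def card_cartesian_product of_nat_diff)
  have "(\<Sum>(u, v)\<in>A \<union> (B \<union> prod.swap ` B). (y u + y v)\<^sup>2) \<le> form y"
    unfolding form_def
    by (rule sum_mono2[OF finE])
      (use nk in \<open>auto simp: A_def B_def S_plus_graph_def S_graph_def\<close>)
  also have "(\<Sum>(u, v)\<in>A \<union> (B \<union> prod.swap ` B). (y u + y v)\<^sup>2) =
      (\<Sum>(u, v)\<in>A. (y u + y v)\<^sup>2) + (\<Sum>(u, v)\<in>B \<union> prod.swap ` B. (y u + y v)\<^sup>2)"
    by (rule sum.union_disjoint) (auto simp: A_def B_def)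
  also have "(\<Sum>(u, v)\<in>B \<union> prod.swap ` B. (y u + y v)\<^sup>2) =
      (\<Sum>(u, v)\<in>B. (y u + y v)\<^sup>2) + (\<Sum>(u, v)\<in>prod.swap ` B. (y u + y v)\<^sup>2)"
    by (rule sum.union_disjoint) (auto simp: B_def)
  also have "(\<Sum>(u, v)\<in>prod.swap ` B. (y u + y v)\<^sup>2) = (\<Sum>(u, v)\<in>B. (y u + y v)\<^sup>2)"
    by (subst sum.reindex) (auto simp: case_prod_beta add.commute)
  also have "(\<Sum>(u, v)\<in>A. (y u + y v)\<^sup>2) = (\<Sum>_\<in>A. 4)"
    by (rule sum.cong) (auto simp: A_def y_def)
  also have "(\<Sum>(u, v)\<in>B. (y u + y v)\<^sup>2) = (\<Sum>_\<in>B. (1 + t)\<^sup>2)"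
    by (rule sum.cong) (auto simp: B_def y_def)
  finally have "4 * (real k * real k - real k) + 2 * (real k * (real n - real k) * (1 + t)\<^sup>2) \<le> form y"
    by (simp add: cA cB)
  also have "\<dots> \<le> 2 * ?q * nsq y" by (rule Ray)
  also have "nsq y = real k + (real n - real k) * t\<^sup>2"
  proof -
    have "nsq y = (\<Sum>v\<in>{..<n}. (y v)\<^sup>2)" unfolding nsq_def unfolding V ..
    also have "{..<n} = {..<k} \<union> {k..<n}" using nk by auto
    also have "(\<Sum>v\<in>{..<k} \<union> {k..<n}. (y v)\<^sup>2) = (\<Sum>v\<in>{..<k}. (y v)\<^sup>2) + (\<Sum>v\<in>{k..<n}. (y v)\<^sup>2)"
      by (rule sum.union_disjoint) auto
    also have "\<dots> = (\<Sum>v\<in>{..<k}. 1) + (\<Sum>v\<in>{k..<n}. t\<^sup>2)"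
      by (intro arg_cong2[of _ _ _ _ "(+)"] sum.cong) (auto simp: y_def)
    finally show ?thesis using nk by (simp add: of_nat_diff)
  qed
  \<comment> \<open>Substituting k = t n exposes the common factor 2 t n, which is then
    cancelled.\<close>
  finally have "(2 * t * real n) * (2 * (t * real n - 1) + real n * (1 - t) * (1 + t)\<^sup>2) \<le>
      (2 * t * real n) * (?q * (1 + (1 - t) * t))"
    unfolding tk by (simp add: power2_eq_square algebra_simps)
  moreover have "2 * t * real n > 0" using t npos by simp
  ultimately have ub: "2 * (t * real n - 1) + real n * (1 - t) * (1 + t)\<^sup>2 \<le> ?q * (1 + (1 - t) * t)"
    by (rule mult_left_le_imp_le)
  \<comment> \<open>This is n + 2k - 2 - 2k^2/n, the Rayleigh quotient up to a nonnegative
    remainder. The term 2k^2/n is at most 1/200 because n \<ge> 400 k^2.\<close>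
  define c where "c = real n + 2 * t * real n - 2 - 2 * t\<^sup>2 * real n"
  have "2 * (t * real n - 1) + real n * (1 - t) * (1 + t)\<^sup>2 - c * (1 + (1 - t) * t) =
      real n * t^3 * (3 - 2 * t) + 2 * t * (1 - t)"
    by (simp add: c_def power2_eq_square power3_eq_cube algebra_simps)
  moreover have "\<dots> \<ge> 0" using t npos by (intro add_nonneg_nonneg mult_nonneg_nonneg) auto
  ultimately have "c * (1 + (1 - t) * t) \<le> ?q * (1 + (1 - t) * t)" using ub by linarith
  moreover have "1 + (1 - t) * t > 0" using t by (intro add_pos_nonneg mult_nonneg_nonneg) auto
  ultimately have "c \<le> ?q" by (rule mult_right_le_imp_le)
  moreover have "2 * t\<^sup>2 * real n \<le> 1 / 200"
  proof -
    have "400 * (real k)\<^sup>2 \<le> real n" using of_nat_mono[OF n, where ?'a = real] by simp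
    then show ?thesis using npos by (simp add: t_def power2_eq_square field_simps)
  qed
  ultimately show ?thesis by (simp add: c_def tk)
qed

text \<open>Listing \<open>L\<close> first, then \<open>a\<close> and \<open>b\<close>, then the
  remaining vertices puts the clique on the indices below \<open>k\<close> and the added edge on
  \<open>k\<close> and k + 1.\<close>

lemma S_plus_relabelling:
  assumes V: "finite V" "card V = n" and L: "L \<subseteq> V" "card L = k"
    and ab: "a \<in> V - L" "b \<in> V - L" "a \<noteq> b"
  obtains \<psi> where "bij_betw \<psi> {..<n} V"
    "\<And>i j. i < n \<Longrightarrow> j < n \<Longrightarrow> (\<psi> i, \<psi> j) \<in> join_plus V L a b \<longleftrightarrow> (i, j) \<in> parcs (S_plus_graph n k)"
proof -
  have "finite L" using L V finite_subset by blast
  then obtain ls where ls: "set ls = L" "distinct ls" by (meson finite_distinct_list)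
  obtain rs where rs: "set rs = V - L - {a, b}" "distinct rs"
    using V by (meson finite_distinct_list finite_Diff)
  have len: "length ls = k" using ls L distinct_card by metis
  define zs where "zs = ls @ a # b # rs"
  have zs: "distinct zs" "set zs = V" using ls rs L ab by (auto simp: zs_def)
  have lenz: "length zs = n" using zs V distinct_card by metis
  have zL: "zs ! i \<in> L \<longleftrightarrow> i < k" if "i < n" for i
  proof (cases "i < k")
    case True
    then show ?thesis using len ls by (simp add: zs_def nth_append) (metis nth_mem)
  next
    case False
    then have "zs ! i = (a # b # rs) ! (i - k)" by (simp add: zs_def nth_append len)
    moreover have "i - k < length (a # b # rs)"
      using that False lenz len by (auto simp: zs_def)
    ultimately have "zs ! i \<in> set (a # b # rs)" by (metis nth_mem)
    then show ?thesis using False rs ab by auto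
  qed
  have kn: "k < n" "k + 1 < n" using lenz len by (auto simp: zs_def)
  have zab: "zs ! k = a" "zs ! (k + 1) = b" by (simp_all add: zs_def nth_append len)
  have zeq: "zs ! i = zs ! j \<longleftrightarrow> i = j" if "i < n" "j < n" for i j
    using that zs(1) lenz nth_eq_iff_index_eq by metis
  have za: "zs ! i = a \<longleftrightarrow> i = k" "zs ! i = b \<longleftrightarrow> i = k + 1" if "i < n" for i
    using zeq[OF that kn(1)] zeq[OF that kn(2)] zab by auto
  show ?thesis
  proof (rule that[of "(!) zs"])
    show "bij_betw ((!) zs) {..<n} V" by (rule bij_betw_nth) (use zs lenz in auto)
    fix i j assume ij: "i < n" "j < n"
    then have "zs ! i \<in> V" "zs ! j \<in> V" using zs(2) lenz nth_mem by blast+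
    then show "(zs ! i, zs ! j) \<in> join_plus V L a b \<longleftrightarrow> (i, j) \<in> parcs (S_plus_graph n k)"
      using ij by (auto simp: join_plus_def S_plus_graph_def S_graph_def zL zeq za)
  qed
qed

lemma parcs_S_plus_sub:
  assumes "k + 2 \<le> n"
  shows "parcs (S_plus_graph n k) \<subseteq> {..<n} \<times> {..<n}"
  using assms by (auto simp: S_plus_graph_def S_graph_def)

lemma join_plus_sub:
  assumes "a \<in> V - L" "b \<in> V - L"
  shows "join_plus V L a b \<subseteq> V \<times> V"
  using assms by (auto simp: join_plus_def)

text \<open>Both claims transport along the relabelling: the Rayleigh bound pulls a weight on
  \<open>V\<close> back to {..<n}, and the inverse relabelling is the isomorphism.\<close>

lemma
  assumes V: "finite V" "card V = n" and L: "L \<subseteq> V" "card L = k"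
    and ab: "a \<in> V - L" "b \<in> V - L" "a \<noteq> b"
  shows join_plus_Rayleigh: "(\<Sum>(u, v)\<in>join_plus V L a b. (x u + x v)\<^sup>2) \<le>
      2 * Q_index (S_plus_graph n k) * (\<Sum>v\<in>V. (x v)\<^sup>2)" (is ?A)
    and join_plus_iso: "pair_graph G \<Longrightarrow> pverts G = V \<Longrightarrow> parcs G = join_plus V L a b \<Longrightarrow>
      digraph_iso (with_proj G) (with_proj (S_plus_graph n k))"
proof -
  let ?P = "parcs (S_plus_graph n k)"
  obtain \<psi> where bij: "bij_betw \<psi> {..<n} V"
    and \<psi>: "\<And>i j. i < n \<Longrightarrow> j < n \<Longrightarrow> (\<psi> i, \<psi> j) \<in> join_plus V L a b \<longleftrightarrow> (i, j) \<in> ?P"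
    using S_plus_relabelling[OF assms] by blast
  have "finite L" using L V finite_subset by blast
  then have "card (insert a (insert b L)) = k + 2" using ab L by simp
  moreover have "card (insert a (insert b L)) \<le> n" using V L ab by (metis DiffD1 card_mono insert_subset)
  ultimately have kn: "k + 2 \<le> n" by simp
  have G: "pair_graph (S_plus_graph n k)" using kn by (rule pair_graph_S_plus_graph)
  have PV: "pverts (S_plus_graph n k) = {..<n}" by (simp add: S_plus_graph_def S_graph_def)
  note Psub = parcs_S_plus_sub[OF kn] and Jsub = join_plus_sub[OF ab(1,2)]
  have im: "join_plus V L a b = map_prod \<psi> \<psi> ` ?P"
  proof (intro equalityI subsetI)
    fix e assume e: "e \<in> join_plus V L a b"
    then obtain i j where ij: "e = (\<psi> i, \<psi> j)" "i < n" "j < n"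
      using Jsub bij by (force simp: bij_betw_def)
    then have "(i, j) \<in> ?P" using e \<psi> by blast
    then show "e \<in> map_prod \<psi> \<psi> ` ?P" using ij by force
  next
    fix e assume "e \<in> map_prod \<psi> \<psi> ` ?P"
    then show "e \<in> join_plus V L a b" using \<psi> Psub by auto
  qed
  have inj: "inj_on \<psi> {..<n}" using bij by (simp add: bij_betw_def)
  then have injP: "inj_on (map_prod \<psi> \<psi>) ?P"
    using map_prod_inj_on[OF inj inj] Psub inj_on_subset by blast
  have "(\<Sum>(u, v)\<in>join_plus V L a b. (x u + x v)\<^sup>2) = (\<Sum>(i, j)\<in>?P. (x (\<psi> i) + x (\<psi> j))\<^sup>2)"
    unfolding im by (subst sum.reindex[OF injP]) (auto simp: case_prod_beta)
  also have "\<dots> \<le> 2 * Q_index (S_plus_graph n k) * (\<Sum>i<n. (x (\<psi> i))\<^sup>2)"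
  proof -
    interpret sgraph "pverts (S_plus_graph n k)" ?P by (rule sgraph_pair_graph[OF G])
    have "pverts (S_plus_graph n k) \<noteq> {}" using kn unfolding PV by (auto simp: lessThan_empty_iff)
    then have "form (x \<circ> \<psi>) \<le> 2 * Q_index (S_plus_graph n k) * nsq (x \<circ> \<psi>)"
      using Q_index_spectral[OF G] by blast
    then show ?thesis by (simp add: form_def nsq_def[unfolded PV] PV)
  qed
  also have "(\<Sum>i<n. (x (\<psi> i))\<^sup>2) = (\<Sum>v\<in>V. (x v)\<^sup>2)"
    by (rule sum.reindex_bij_betw[OF bij])
  finally show ?A .
  assume G': "pair_graph G" "pverts G = V" "parcs G = join_plus V L a b"
  interpret pair_graph G by fact
  define \<phi> where "\<phi> = the_inv_into {..<n} \<psi>"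
  have bij\<phi>: "bij_betw \<phi> V {..<n}"
    unfolding \<phi>_def using bij by (rule bij_betw_the_inv_into)
  then have inj\<phi>: "inj_on \<phi> V" "\<phi> ` V = {..<n}" by (auto simp: bij_betw_def)
  have \<phi>\<psi>: "\<phi> (\<psi> i) = i" if "i < n" for i
    using the_inv_into_f_f[OF inj, of i] that by (simp add: \<phi>_def)
  have "map_prod \<phi> \<phi> ` join_plus V L a b = id ` ?P"
    unfolding im image_image
    by (rule image_cong) (use Psub in \<open>auto simp: \<phi>\<psi>\<close>)
  moreover have "inj_on (map_prod \<phi> \<phi>) (join_plus V L a b)"
    using map_prod_inj_on[OF inj\<phi>(1) inj\<phi>(1)] Jsub inj_on_subset by blast
  ultimately have arcs: "map_prod \<phi> \<phi> ` parcs G = ?P" "inj_on (map_prod \<phi> \<phi>) (parcs G)"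
    by (simp_all add: G')
  let ?f = "\<lparr>iso_verts = \<phi>, iso_arcs = map_prod \<phi> \<phi>, iso_head = snd, iso_tail = fst\<rparr>"
  have "wf_digraph (with_proj G)" by unfold_locales
  then have "pre_digraph.digraph_isomorphism (with_proj G) ?f"
    unfolding pre_digraph.digraph_isomorphism_def using arcs(2) inj\<phi>(1) by (simp add: G'(2))
  moreover have "with_proj (S_plus_graph n k) = app_iso ?f (with_proj G)"
    by (simp add: app_iso_def with_proj_def PV arcs(1) G'(2) inj\<phi>(2))
  ultimately show "digraph_iso (with_proj G) (with_proj (S_plus_graph n k))"
    unfolding digraph_iso_def by blast
qed

context sgraph
begin

text \<open>Replacing \<open>G\<close> by \<open>S\<^sub>n\<^sub>,\<^sub>k\<^sup>+\<close> loses only edges between vertices of weight \<open>O(k/n)\<close>, at most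
  \<open>51n/100\<close> of them at each vertex that misses part of \<open>L\<close>, and gains an edge of weight at least
  \<open>(22/25)\<^sup>2\<close> at each such vertex.\<close>

lemma form_less_join_plus:
  fixes x :: "'a \<Rightarrow> real" and q :: real
  defines "n \<equiv> card V"
  assumes k: "k \<ge> 2" and n: "n \<ge> 400 * k\<^sup>2" and cyc: "\<not> has_cycle (2 * k + 2)"
    and x: "\<And>v. v \<in> V \<Longrightarrow> 0 \<le> x v" and q: "q > 0"
    and eig: "\<And>v. v \<in> V \<Longrightarrow> Qop x v = q * x v"
    and L: "L \<subseteq> V" "card L = k" and xL: "\<And>l. l \<in> L \<Longrightarrow> x l \<ge> 22 / 25"
    and com: "\<And>a b. a \<in> L \<Longrightarrow> b \<in> L \<Longrightarrow> a \<noteq> b \<Longrightarrow> 8 * k \<le> card (nb a \<inter> nb b)"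
    and x_small: "\<And>v. v \<in> V - L \<Longrightarrow> x v \<le> 11 / 2 * k / n"
    and deg_small: "\<And>v. v \<in> V - L \<Longrightarrow> real (card (nb v)) \<le> 51 / 100 * n"
  obtains a b where "a \<in> V - L" "b \<in> V - L" "a \<noteq> b"
    "E \<noteq> join_plus V L a b \<Longrightarrow> form x < (\<Sum>(u, v)\<in>join_plus V L a b. (x u + x v)\<^sup>2)"
proof -
  \<comment> \<open>\<open>U\<close> collects the vertices outside \<open>L\<close> that miss some
    member of \<open>L\<close>; those in \<open>W\<close> are adjacent to all of
    \<open>L\<close>.\<close>
  define U where "U = {v \<in> V - L. \<exists>l\<in>L. (v, l) \<notin> E}"
  define W where "W = V - L - U"
  have finL: "finite L" using L finV finite_subset by blast
  have "k \<le> k * k" by (rule le_square)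
  then have "k + 2 \<le> 400 * k\<^sup>2" using k unfolding power2_eq_square by linarith
  then have kn: "k + 2 \<le> n" using n by simp
  have WL: "W \<inter> L = {}" "\<And>u l. u \<in> W \<Longrightarrow> l \<in> L \<Longrightarrow> (u, l) \<in> E"
    by (auto simp: W_def U_def)
  \<comment> \<open>The added edge of the comparison graph is placed on the edge inside
    \<open>W\<close> if there is one, so that it is not lost, and on an arbitrary pair
    otherwise.\<close>
  have "\<exists>a b. a \<in> V - L \<and> b \<in> V - L \<and> a \<noteq> b \<and> (\<forall>c\<in>W. \<forall>d\<in>W. (c, d) \<in> E \<longrightarrow> {a, b} = {c, d})"
  proof (cases "\<exists>a\<in>W. \<exists>b\<in>W. (a, b) \<in> E")
    case True
    then obtain a b where ab: "a \<in> W" "b \<in> W" "(a, b) \<in> E" by blast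
    have "a \<noteq> b" using ab by auto
    moreover have "\<forall>c\<in>W. \<forall>d\<in>W. (c, d) \<in> E \<longrightarrow> {a, b} = {c, d}"
      using at_most_one_edge[OF cyc k finL L(2) com WL ab] by blast
    ultimately show ?thesis using ab by (intro exI[of _ a] exI[of _ b]) (auto simp: W_def)
  next
    case False
    have "2 \<le> card (V - L)" using kn L finL by (simp add: card_Diff_subset n_def)
    then obtain T where "T \<subseteq> V - L" "card T = 2" by (meson obtain_subset_with_card_n)
    then obtain a b where "a \<in> V - L" "b \<in> V - L" "a \<noteq> b" by (auto simp: card_2_iff)
    then show ?thesis using False by blast
  qed
  then obtain a b where ab: "a \<in> V - L" "b \<in> V - L" "a \<noteq> b"
    and abW: "\<And>c d. c \<in> W \<Longrightarrow> d \<in> W \<Longrightarrow> (c, d) \<in> E \<Longrightarrow> {a, b} = {c, d}" by blast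
  define E' where "E' = join_plus V L a b"
  have E'sub: "E' \<subseteq> V \<times> V" unfolding E'_def using ab by (intro join_plus_sub)
  then have finE': "finite E'" using finV finite_subset by blast
  define f where "f = (\<lambda>(u, v). (x u + x v)\<^sup>2)"
  have diff: "(\<Sum>e\<in>E'. f e) - form x = (\<Sum>e\<in>E' - E. f e) - (\<Sum>e\<in>E - E'. f e)"
  proof -
    have "(\<Sum>e\<in>E'. f e) = (\<Sum>e\<in>E' - E. f e) + (\<Sum>e\<in>E' \<inter> E. f e)"
      using sum.Int_Diff[OF finE', of f E] by simp
    moreover have "form x = (\<Sum>e\<in>E - E'. f e) + (\<Sum>e\<in>E' \<inter> E. f e)"
      unfolding form_def f_def[symmetric] using sum.Int_Diff[OF finE, of f E']
      by (simp add: Int_commute)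
    ultimately show ?thesis by simp
  qed
  have f0: "f e \<ge> 0" for e by (simp add: f_def case_prod_beta)
  have lost: "E - E' \<subseteq> Sigma U nb \<union> prod.swap ` Sigma U nb" (is "_ \<subseteq> ?Z")
  proof
    fix e assume e: "e \<in> E - E'"
    obtain u v where uv: "e = (u, v)" by (cases e)
    have "u \<in> V" "v \<in> V" using e uv EV by auto
    moreover have "u \<noteq> v" using e uv by auto
    ultimately have "u \<notin> L" "v \<notin> L" using e uv by (auto simp: E'_def join_plus_def)
    have "\<not> (u \<in> W \<and> v \<in> W)"
    proof
      assume "u \<in> W \<and> v \<in> W"
      then have "{a, b} = {u, v}" using abW e uv by blast
      then have "(u, v) \<in> E'" by (auto simp: E'_def join_plus_def doubleton_eq_iff)
      then show False using e uv by blast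
    qed
    then have "u \<in> U \<or> v \<in> U"
      using \<open>u \<in> V\<close> \<open>v \<in> V\<close> \<open>u \<notin> L\<close> \<open>v \<notin> L\<close> by (auto simp: W_def)
    then show "e \<in> ?Z" using e uv E_commute by force
  qed
  have strict: "form x < (\<Sum>e\<in>E'. f e)" if neq: "E \<noteq> E'"
  proof (cases "U = {}")
    case True
    then have sub: "E \<subseteq> E'" using lost by auto
    then obtain u v where uv: "(u, v) \<in> E' - E" using neq by auto
    \<comment> \<open>If \<open>U\<close> is empty, \<open>E\<close> is a proper subset of
      \<open>E'\<close>, and strictness needs positive weights: each vertex outside \<open>L\<close>
      is adjacent to a member of \<open>L\<close>, whose weight is positive.\<close>
    have pos: "x v > 0" if v: "v \<in> V" for v
    proof (cases "v \<in> L")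
      case True
      then show ?thesis using xL[of v] by simp
    next
      case False
      then have "v \<in> W" using v True by (auto simp: W_def)
      obtain l where l: "l \<in> L" using L k by fastforce
      have "x l \<le> (\<Sum>u\<in>nb v. x u)"
      proof (rule member_le_sum)
        show "0 \<le> x u" if "u \<in> nb v - {l}" for u using x nb_sub that by blast
      qed (use l \<open>v \<in> W\<close> WL in auto)
      also have "\<dots> \<le> Qop x v" using x[OF v] by (simp add: Qop_def)
      finally have "q * x v > 0" using xL[OF l] eig[OF v] by simp
      then show ?thesis using q by (simp add: zero_less_mult_iff)
    qed
    have "0 < f (u, v)" using pos[of u] pos[of v] uv E'sub by (auto simp: f_def)
    also have "\<dots> \<le> (\<Sum>e\<in>E' - E. f e)"
      using uv finE' f0 by (intro member_le_sum) auto
    finally have "0 < (\<Sum>e\<in>E' - E. f e)" .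
    moreover have "E - E' = {}" using sub by blast
    then have "(\<Sum>e\<in>E - E'. f e) = 0" by (simp only: sum.empty)
    ultimately show ?thesis using diff by linarith
  next
    case False
    define m where "m = real (card U)"
    have finU: "finite U" using finV by (simp add: U_def)
    then have m: "m > 0" using False by (simp add: m_def card_gt_0_iff)
    define c where "c = 11 / 2 * real k / real n"
    have npos: "real n > 0" using kn by simp
    have c0: "c \<ge> 0" by (simp add: c_def)
    have "(\<Sum>e\<in>E - E'. f e) \<le> (\<Sum>e\<in>E - E'. (2 * c)\<^sup>2)"
    proof (rule sum_mono)
      fix e assume e: "e \<in> E - E'"
      obtain u v where uv: "e = (u, v)" by (cases e)
      have "u \<in> V" "v \<in> V" "u \<noteq> v" using e uv EV by auto
      then have "u \<in> V - L" "v \<in> V - L" using e uv by (auto simp: E'_def join_plus_def)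
      then have "x u \<le> c" "x v \<le> c" "0 \<le> x u" "0 \<le> x v" using x_small x by (auto simp: c_def)
      then have "(x u + x v)\<^sup>2 \<le> (2 * c)\<^sup>2" by (intro power_mono) auto
      then show "f e \<le> (2 * c)\<^sup>2" by (simp add: uv f_def)
    qed
    also have "\<dots> = real (card (E - E')) * (2 * c)\<^sup>2" by simp
    \<comment> \<open>Every lost arc has an end in \<open>U\<close>, and both orientations are
      counted. With (2 c)^2 = 121 k^2/n^2 the loss is at most 1.02 * 121/400 * m < m/2.\<close>
    also have "real (card (E - E')) \<le> 2 * (51 / 100 * n * m)"
    proof -
      have fS: "finite (Sigma U nb)" using finU by auto
      have "card (E - E') \<le> card ?Z" using lost fS by (intro card_mono) auto
      also have "\<dots> \<le> card (Sigma U nb) + card (prod.swap ` Sigma U nb)" by (rule card_Un_le)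
      also have "card (prod.swap ` Sigma U nb) \<le> card (Sigma U nb)" using fS by (rule card_image_le)
      finally have "card (E - E') \<le> 2 * (\<Sum>u\<in>U. card (nb u))"
        using finU by (simp add: card_SigmaI)
      then have "real (card (E - E')) \<le> 2 * (\<Sum>u\<in>U. real (card (nb u)))"
        by (metis of_nat_le_iff of_nat_mult of_nat_numeral of_nat_sum)
      also have "(\<Sum>u\<in>U. real (card (nb u))) \<le> (\<Sum>u\<in>U. 51 / 100 * n)"
        using deg_small by (intro sum_mono) (auto simp: U_def)
      finally show ?thesis by (simp add: m_def)
    qed
    then have "real (card (E - E')) * (2 * c)\<^sup>2 \<le> 2 * (51 / 100 * n * m) * (2 * c)\<^sup>2"
      by (rule mult_right_mono) simp
    also have "\<dots> = 102 / 100 * 121 * (real k * real k / real n) * m"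
      using npos by (simp add: c_def power2_eq_square)
    also have "\<dots> \<le> 102 / 100 * 121 * (1 / 400) * m"
    proof (intro mult_right_mono mult_left_mono)
      have "400 * (real k)\<^sup>2 \<le> real n" using of_nat_mono[OF n, where ?'a = real] by simp
      then show "real k * real k / real n \<le> 1 / 400" using npos by (simp add: power2_eq_square field_simps)
    qed (use m in auto)
    finally have loss: "(\<Sum>e\<in>E - E'. f e) \<le> 1 / 2 * m" using m by simp
    \<comment> \<open>Each \<open>u\<close> in \<open>U\<close> gains an arc to a missed member of
      \<open>L\<close>. Their first components differ, so the total gain is at least 0.7744
      m.\<close>
    have "\<forall>u\<in>U. \<exists>l. l \<in> L \<and> (u, l) \<notin> E" by (auto simp: U_def)
    from bchoice[OF this] obtain g where g: "\<And>u. u \<in> U \<Longrightarrow> g u \<in> L \<and> (u, g u) \<notin> E" by blast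
    have UV: "u \<in> V" "u \<notin> L" if "u \<in> U" for u using that by (auto simp: U_def)
    have "m * (22 / 25)\<^sup>2 = (\<Sum>u\<in>U. (22 / 25)\<^sup>2)" by (simp add: m_def)
    also have "\<dots> \<le> (\<Sum>u\<in>U. f (u, g u))"
    proof (rule sum_mono)
      fix u assume u: "u \<in> U"
      then have "22 / 25 \<le> x u + x (g u)" using xL[of "g u"] x[of u] g UV by force
      then have "(22 / 25)\<^sup>2 \<le> (x u + x (g u))\<^sup>2" by (intro power_mono) auto
      then show "(22 / 25)\<^sup>2 \<le> f (u, g u)" by (simp add: f_def)
    qed
    also have "\<dots> = (\<Sum>e\<in>(\<lambda>u. (u, g u)) ` U. f e)"
      by (subst sum.reindex) (auto simp: inj_on_def)
    also have "\<dots> \<le> (\<Sum>e\<in>E' - E. f e)"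
    proof (rule sum_mono2)
      show "(\<lambda>u. (u, g u)) ` U \<subseteq> E' - E"
        using g UV L(1) by (fastforce simp: E'_def join_plus_def)
    qed (use finE' f0 in auto)
    finally have "m * (22 / 25)\<^sup>2 \<le> (\<Sum>e\<in>E' - E. f e)" .
    moreover have "1 / 2 * m < m * (22 / 25)\<^sup>2" using m by (simp add: power2_eq_square)
    ultimately show ?thesis using loss diff by linarith
  qed
  show ?thesis
    by (rule that[OF ab]) (use strict in \<open>simp add: E'_def f_def\<close>)
qed

end

theorem theorem2:
  fixes k n :: nat and G :: "'a pair_pre_digraph"
  assumes "k \<ge> 2" and "n \<ge> 400 * k ^ 2"
    and "pair_graph G" and "card (pverts G) = n"
    and "\<not> (\<exists>p. pre_digraph.cycle (with_proj G) p \<and> length p = 2 * k + 2)"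
    and "\<not> digraph_iso (with_proj G) (with_proj (S_plus_graph n k))"
  shows "Q_index G < Q_index (S_plus_graph n k)"
proof (rule ccontr)
  let ?q = "Q_index G" and ?qS = "Q_index (S_plus_graph n k)"
  assume "\<not> ?q < ?qS"
  then have qq0: "?qS \<le> ?q" by simp
  interpret sgraph "pverts G" "parcs G" by (rule sgraph_pair_graph) fact
  note kn = assms(1,2)
  have cyc: "\<not> has_cycle (2 * k + 2)" using cycle_of_has_cycle assms(3,5) by blast
  have "0 < k\<^sup>2" using kn(1) by simp
  then have "n > 0" using kn(2) by linarith
  then have ne: "pverts G \<noteq> {}" using assms(4) by auto
  have q: "?q \<ge> real n + 2 * real k - 2 - 1 / 200"
    using Q_index_S_plus_ge[OF kn] qq0 by simp
  have qpos: "?q > 0" using q kn(1) \<open>n > 0\<close> by simp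
  obtain z where z: "\<And>v. z v \<ge> 0" "\<exists>v\<in>pverts G. z v \<noteq> 0"
    "\<And>v. v \<in> pverts G \<Longrightarrow> Qop z v = ?q * z v" "\<And>y. form y \<le> 2 * ?q * nsq y"
    by (rule Q_index_spectral[OF assms(3) ne]) (blast intro: that)
  define M where "M = Max (z ` pverts G)"
  have "M \<in> z ` pverts G" unfolding M_def using finV ne by (intro Max_in) auto
  then obtain w where w: "w \<in> pverts G" "z w = M" by auto
  have zM: "z v \<le> M" if "v \<in> pverts G" for v unfolding M_def using finV that by simp
  obtain v0 where "v0 \<in> pverts G" "z v0 \<noteq> 0" using z(2) by blast
  then have M: "M > 0" using z(1)[of v0] zM[of v0] by linarith
  \<comment> \<open>The eigenvector is scaled to maximum 1, the normalisation used in
    \<open>dominating_set\<close>.\<close>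
  define x where "x v = z v / M" for v
  have x: "0 \<le> x v" for v using z(1) M by (simp add: x_def)
  have x1: "x v \<le> 1" if "v \<in> pverts G" for v using zM[OF that] M by (simp add: x_def)
  have xw: "x w = 1" using w M by (simp add: x_def)
  have eig: "Qop x v = ?q * x v" if "v \<in> pverts G" for v
    using z(3)[OF that] by (simp add: Qop_def x_def sum_divide_distrib[symmetric] add_divide_distrib[symmetric])
  note kn' = kn[folded assms(4)] and q' = q[folded assms(4)]
  obtain L where L: "L \<subseteq> pverts G" "card L = k" "\<And>l. l \<in> L \<Longrightarrow> x l \<ge> 22 / 25"
    "\<And>a b. a \<in> L \<Longrightarrow> b \<in> L \<Longrightarrow> a \<noteq> b \<Longrightarrow> 8 * k \<le> card (nb a \<inter> nb b)"
    "\<And>v. v \<in> pverts G - L \<Longrightarrow> x v \<le> 11 / 2 * k / card (pverts G)"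
    "\<And>v. v \<in> pverts G - L \<Longrightarrow> real (card (nb v)) \<le> 51 / 100 * card (pverts G)"
    using dominating_set[OF kn' cyc x x1 w(1) xw eig q'] by blast
  obtain a b where ab: "a \<in> pverts G - L" "b \<in> pverts G - L" "a \<noteq> b"
    and less: "parcs G \<noteq> join_plus (pverts G) L a b \<Longrightarrow>
      form x < (\<Sum>(u, v)\<in>join_plus (pverts G) L a b. (x u + x v)\<^sup>2)"
    using form_less_join_plus[OF kn' cyc x qpos eig L] by blast
  have "parcs G \<noteq> join_plus (pverts G) L a b"
    using join_plus_iso[OF finV assms(4) L(1,2) ab assms(3)] assms(6) by blast
  \<comment> \<open>The comparison graph has a strictly larger form at \<open>x\<close>, yet its
    Rayleigh bound together with \<open>qq0\<close> caps it by 2 q nsq x, which equals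
    \<open>form x\<close>.\<close>
  then have "form x < (\<Sum>(u, v)\<in>join_plus (pverts G) L a b. (x u + x v)\<^sup>2)" by (rule less)
  also have "\<dots> \<le> 2 * ?qS * nsq x"
    unfolding nsq_def by (rule join_plus_Rayleigh[OF finV assms(4) L(1,2) ab])
  also have "\<dots> \<le> 2 * ?q * nsq x" using qq0 nsq_nonneg by (intro mult_right_mono) auto
  also have "\<dots> = form x"
    unfolding form_Qop nsq_def sum_distrib_left
    by (rule sum.cong) (auto simp: eig power2_eq_square)
  finally show False by simp
qed

end
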